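(* Let $\gamma,\tau>0$ and consider the Stochastic PDDY algorithm: given $p^0\in\mathcal{X}$, $y^0\in\mathcal{Y}$, for $k=0,1,2,\dots$ $$\begin{aligned} y^{k+1}&=\mathrm{prox}_{\tau H^*}\big(y^k+\tau L(p^k-\gamma L^*y^k)\big),\\ x^k&=p^k-\gamma L^*y^{k+1},\\ s^{k+1}&=\mathrm{prox}_{\gamma R}\big(2x^k-p^k-\gamma g^{k+1}\big),\\ p^{k+1}&=p^k+s^{k+1}-x^k,\end{aligned}$$ where $(g^k)$ satisfies the Stochastic Gradient Assumption (see context) with constants $\alpha,\beta,\delta\ge0$, $\rho\in(0,1]$ and process $(\sigma_k)$. Let $\kappa:=\beta/\rho$ and suppose that $\gamma\le\frac{1}{2(\alpha+\kappa\delta)}$ and $\gamma\tau\|L\|^2<1$. Define $V^0:=\|v^0-v^\star\|_P^2+\gamma^2\kappa\sigma_0^2$, where $v^0=(p^0,y^0)$. Then, for every integer $k\ge1$, $$\mathbb{E}\big(D_F(\bar x^k,x^\star)+D_{H^*}(\bar y^{k+1},y^\star)+D_R(\bar s^{k+1},s^\star)\big)\le\frac{V^0}{k\gamma},$$ where $\bar x^k=\frac1k\sum_{j=0}^{k-1}x^j$, $\bar y^{k+1}=\frac1k\sum_{j=1}^ky^j$ and $\bar s^{k+1}=\frac1k\sum_{j=1}^ks^j$.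
   Context: $\mathcal{X},\mathcal{Y}$ are finite-dimensional real Hilbert spaces, $L:\mathcal{X}\to\mathcal{Y}$ is a linear operator with adjoint $L^*$ and operator norm $\|L\|$. $F:\mathcal{X}\to\mathbb{R}$ is convex and $\nu$-smooth for some $\nu>0$ (differentiable with $\nu$-Lipschitz gradient). $R:\mathcal{X}\to\mathbb{R}\cup\{+\infty\}$ and $H:\mathcal{Y}\to\mathbb{R}\cup\{+\infty\}$ are proper, convex, lower semicontinuous. $G^*$ is the convex conjugate and $\mathrm{prox}_G(z)=\arg\min_{z'}\{G(z')+\tfrac12\|z-z'\|^2\}$. Standing assumption: there exist $(x^\star,y^\star)\in\mathcal{X}\times\mathcal{Y}$, $r^\star\in\partial R(x^\star)$ and $h^\star\in\partial H^*(y^\star)$ with $\nabla F(x^\star)+r^\star+L^*y^\star=0$ and $h^\star=Lx^\star$; these are fixed. Set $s^\star=x^\star$ and $v^\star=(p^\star,y^\star)$ with $p^\star=x^\star+\gamma L^*y^\star$ (the fixed point of the iteration associated with $(x^\star,y^\star)$). The norm $\|\cdot\|_P$ on $\mathcal{X}\times\mathcal{Y}$ is $\|(x,y)\|_P^2=\|x\|^2+\frac{\gamma}{\tau}\|y\|^2-\gamma^2\|L^*y\|^2$. Bregman divergences: $D_F(x,x')=F(x)-F(x')-\langle\nabla F(x'),x-x'\rangle$, $D_R(x,x^\star)=R(x)-R(x^\star)-\langle r^\star,x-x^\star\rangle$, $D_{H^*}(y,y^\star)=H^*(y)-H^*(y^\star)-\langle h^\star,y-y^\star\rangle$. Stochastic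 Gradient Assumption: on a filtered probability space $(\Omega,\mathscr{F},(\mathscr{F}_k)_{k\in\mathbb{N}},\mathbb{P})$, with $\mathbb{E}_k$ the conditional expectation given $\mathscr{F}_k$, $(g^k)$ is an $(\mathscr{F}_k)$-adapted $\mathcal{X}$-valued process and there exist $\alpha,\beta,\delta\ge0$, $\rho\in(0,1]$ and a real $(\mathscr{F}_k)$-adapted process $(\sigma_k)_{k\in\mathbb{N}}$ such that for every $k\in\mathbb{N}$: $\mathbb{E}_k(g^{k+1})=\nabla F(x^k)$; $\mathbb{E}_k\|g^{k+1}-\nabla F(x^\star)\|^2\le2\alpha D_F(x^k,x^\star)+\beta\sigma_k^2$; $\mathbb{E}_k(\sigma_{k+1}^2)\le(1-\rho)\sigma_k^2+2\delta D_F(x^k,x^\star)$, where $x^k$ are the iterates of the algorithm. The initial data $p^0,y^0,\sigma_0$ are deterministic. *)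

theory Defs
  imports "HOL-Probability.Probability"
begin

definition proper_fun :: "('a \<Rightarrow> ereal) \<Rightarrow> bool" where
  "proper_fun G \<longleftrightarrow> (\<forall>x. G x \<noteq> -\<infinity>) \<and> (\<exists>x. G x \<noteq> \<infinity>)"

text \<open>At the end points of the segment the convention \<open>0 * \<infinity> = 0\<close> of \<^typ>\<open>ereal\<close> makes
  the inequality trivial, as it should be. The notion is meant for functions that never
  take the value \<open>-\<infinity>\<close>.\<close>

definition convex_fun :: "('a::real_vector \<Rightarrow> ereal) \<Rightarrow> bool" where
  "convex_fun G \<longleftrightarrow> (\<forall>x y u v. 0 \<le> u \<longrightarrow> 0 \<le> v \<longrightarrow> u + v = 1 \<longrightarrow>
     G (u *\<^sub>R x + v *\<^sub>R y) \<le> ereal u * G x + ereal v * G y)"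

definition lsc_fun :: "('a::topological_space \<Rightarrow> ereal) \<Rightarrow> bool" where
  "lsc_fun G \<longleftrightarrow> (\<forall>x. G x \<le> Liminf (at x) G)"

definition proper_convex_lsc :: "('a::real_normed_vector \<Rightarrow> ereal) \<Rightarrow> bool" where
  "proper_convex_lsc G \<longleftrightarrow> proper_fun G \<and> convex_fun G \<and> lsc_fun G"

definition conjugate :: "('a::real_inner \<Rightarrow> ereal) \<Rightarrow> 'a \<Rightarrow> ereal" where
  "conjugate G y = (SUP x. ereal (x \<bullet> y) - G x)"

definition subdifferential :: "('a::real_inner \<Rightarrow> ereal) \<Rightarrow> 'a \<Rightarrow> 'a set" where
  "subdifferential G x = {g. \<forall>z. G x + ereal (g \<bullet> (z - x)) \<le> G z}"

text \<open>The minimizer is unique for proper, convex, lower semicontinuous \<open>G\<close>, so the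
  choice made by \<^const>\<open>arg_min\<close> is immaterial.\<close>

definition prox :: "('a::real_inner \<Rightarrow> ereal) \<Rightarrow> 'a \<Rightarrow> 'a" where
  "prox G z = (ARG_MIN (\<lambda>w. G w + ereal ((norm (z - w))\<^sup>2 / 2)) w. True)"

definition convex_smooth ::
  "real \<Rightarrow> ('a::real_inner \<Rightarrow> real) \<Rightarrow> ('a \<Rightarrow> 'a) \<Rightarrow> bool" where
  "convex_smooth \<nu> F gradF \<longleftrightarrow>
     convex_on UNIV F \<and> (\<forall>x. GDERIV F x :> gradF x) \<and> \<nu>-lipschitz_on UNIV gradF"

definition bregman_smooth ::
  "('a::real_inner \<Rightarrow> real) \<Rightarrow> ('a \<Rightarrow> 'a) \<Rightarrow> 'a \<Rightarrow> 'a \<Rightarrow> real" where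
  "bregman_smooth F gradF x x' = F x - F x' - gradF x' \<bullet> (x - x')"

text \<open>Here \<open>g\<close> is a fixed subgradient of \<open>G\<close> at \<open>x'\<close>.\<close>

definition bregman ::
  "('a::real_inner \<Rightarrow> ereal) \<Rightarrow> 'a \<Rightarrow> 'a \<Rightarrow> 'a \<Rightarrow> ereal" where
  "bregman G g x x' = G x - G x' - ereal (g \<bullet> (x - x'))"

definition norm_P :: "real \<Rightarrow> real \<Rightarrow> ('a::euclidean_space \<Rightarrow> 'b::euclidean_space) \<Rightarrow>
    'a \<times> 'b \<Rightarrow> real" where
  "norm_P \<gamma> \<tau> L v =
     sqrt ((norm (fst v))\<^sup>2 + \<gamma> / \<tau> * (norm (snd v))\<^sup>2 - \<gamma>\<^sup>2 * (norm (adjoint L (snd v)))\<^sup>2)"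

definition vec_cond_exp ::
  "'w measure \<Rightarrow> 'w measure \<Rightarrow> ('w \<Rightarrow> 'a::euclidean_space) \<Rightarrow> 'w \<Rightarrow> 'a" where
  "vec_cond_exp M N X \<omega> = (\<Sum>b\<in>Basis. real_cond_exp M N (\<lambda>\<omega>'. X \<omega>' \<bullet> b) \<omega> *\<^sub>R b)"

text \<open>Conditional expectations of squares are taken in \<^typ>\<open>ennreal\<close>, where they exist
  without any integrability assumption; \<^const>\<open>real_cond_exp\<close> has unspecific values
  for functions that are not integrable.\<close>

definition stochastic_gradient_assumption ::
  "'w measure \<Rightarrow> (nat \<Rightarrow> 'w measure) \<Rightarrow>
   ('a::euclidean_space \<Rightarrow> real) \<Rightarrow> ('a \<Rightarrow> 'a) \<Rightarrow> 'a \<Rightarrow>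
   (nat \<Rightarrow> 'w \<Rightarrow> 'a) \<Rightarrow> (nat \<Rightarrow> 'w \<Rightarrow> 'a) \<Rightarrow> (nat \<Rightarrow> 'w \<Rightarrow> real) \<Rightarrow>
   real \<Rightarrow> real \<Rightarrow> real \<Rightarrow> real \<Rightarrow> bool" where
  "stochastic_gradient_assumption M \<FF> F gradF xs x g \<sigma> \<alpha> \<beta> \<delta> \<rho> \<longleftrightarrow>
     0 \<le> \<alpha> \<and> 0 \<le> \<beta> \<and> 0 \<le> \<delta> \<and> 0 < \<rho> \<and> \<rho> \<le> 1 \<and>
     (\<forall>k. g k \<in> borel_measurable (\<FF> k)) \<and>
     (\<forall>k. \<sigma> k \<in> borel_measurable (\<FF> k)) \<and>
     (\<forall>k. AE \<omega> in M. vec_cond_exp M (\<FF> k) (g (Suc k)) \<omega> = gradF (x k \<omega>)) \<and>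
     (\<forall>k. AE \<omega> in M.
        nn_cond_exp M (\<FF> k) (\<lambda>\<omega>'. ennreal ((norm (g (Suc k) \<omega>' - gradF xs))\<^sup>2)) \<omega>
        \<le> ennreal (2 * \<alpha> * bregman_smooth F gradF (x k \<omega>) xs + \<beta> * (\<sigma> k \<omega>)\<^sup>2)) \<and>
     (\<forall>k. AE \<omega> in M.
        nn_cond_exp M (\<FF> k) (\<lambda>\<omega>'. ennreal ((\<sigma> (Suc k) \<omega>')\<^sup>2)) \<omega>
        \<le> ennreal ((1 - \<rho>) * (\<sigma> k \<omega>)\<^sup>2 + 2 * \<delta> * bregman_smooth F gradF (x k \<omega>) xs))"

text \<open>The value of \<open>s 0\<close> is left unconstrained: the iteration only produces \<open>s\<close> from index 1 on.\<close>

definition stochastic_PDDY ::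
  "'w set \<Rightarrow> real \<Rightarrow> real \<Rightarrow> ('a::euclidean_space \<Rightarrow> 'b::euclidean_space) \<Rightarrow>
   ('a \<Rightarrow> ereal) \<Rightarrow> ('b \<Rightarrow> ereal) \<Rightarrow> (nat \<Rightarrow> 'w \<Rightarrow> 'a) \<Rightarrow> 'a \<Rightarrow> 'b \<Rightarrow>
   (nat \<Rightarrow> 'w \<Rightarrow> 'a) \<Rightarrow> (nat \<Rightarrow> 'w \<Rightarrow> 'b) \<Rightarrow> (nat \<Rightarrow> 'w \<Rightarrow> 'a) \<Rightarrow> (nat \<Rightarrow> 'w \<Rightarrow> 'a) \<Rightarrow> bool" where
  "stochastic_PDDY \<Omega> \<gamma> \<tau> L R H g p0 y0 p y x s \<longleftrightarrow>
     (\<forall>\<omega>\<in>\<Omega>. p 0 \<omega> = p0 \<and> y 0 \<omega> = y0 \<and>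
       (\<forall>k.
         y (Suc k) \<omega> = prox (\<lambda>z. ereal \<tau> * conjugate H z)
                          (y k \<omega> + \<tau> *\<^sub>R L (p k \<omega> - \<gamma> *\<^sub>R adjoint L (y k \<omega>))) \<and>
         x k \<omega> = p k \<omega> - \<gamma> *\<^sub>R adjoint L (y (Suc k) \<omega>) \<and>
         s (Suc k) \<omega> = prox (\<lambda>z. ereal \<gamma> * R z)
                          (2 *\<^sub>R x k \<omega> - p k \<omega> - \<gamma> *\<^sub>R g (Suc k) \<omega>) \<and>
         p (Suc k) \<omega> = p k \<omega> + s (Suc k) \<omega> - x k \<omega>))"

end

theory Submission
  imports Defs
begin

text \<open>
  The optimality conditions of the two proximal steps provide subgradients
  $h \in \partial H^*(y^{k+1})$ and $r \in \partial R(s^{k+1})$. Expanding the squares gives, pointwise,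
  \[ \|v^{k+1}-v^\star\|_P^2 \le \|v^k-v^\star\|_P^2
     - 2\gamma\langle g^{k+1}-g^\star, x^k-x^\star\rangle
     - 2\gamma\langle r-r^\star, s^{k+1}-x^\star\rangle
     - 2\gamma\langle h-h^\star, y^{k+1}-y^\star\rangle
     + \gamma^2\|g^{k+1}-g^\star\|^2 . \]
  In expectation $g^{k+1}$ may be replaced by $\nabla F(x^k)$ in the first inner product, which then
  dominates $D_F(x^k,x^\star)$, and the weight $\gamma^2\kappa$ on $\sigma_k^2$ absorbs the variance, leaving
  $\mathbb{E} V^{k+1} \le \mathbb{E} V^k - \gamma\,\mathbb{E}(D_F + \mbox{gaps})$. Telescoping and convexity of the
  divergences conclude. All integrals are finite because every iterate is a Lipschitz function of
  square-integrable variables.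
\<close>

section \<open>Extended-valued convex functions and their proximal operators\<close>

lemma convex_funI:
  assumes "\<And>x. G x \<noteq> -\<infinity>"
    and "\<And>x y a b u v. \<lbrakk>G x = ereal a; G y = ereal b; 0 < u; 0 < v; u + v = 1\<rbrakk>
      \<Longrightarrow> G (u *\<^sub>R x + v *\<^sub>R y) \<le> ereal (u * a + v * b)"
  shows "convex_fun G"
  unfolding convex_fun_def
proof (intro allI impI)
  fix x y and u v :: real
  assume uv: "0 \<le> u" "0 \<le> v" "u + v = 1"
  consider "u = 0" | "v = 0" | "0 < u" "0 < v" using uv by linarith
  then show "G (u *\<^sub>R x + v *\<^sub>R y) \<le> ereal u * G x + ereal v * G y"
  proof cases
    case 3
    then show ?thesis
      using assms(1)[of x] assms(1)[of y] assms(2)[of x _ y _ u v] uv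
      by (cases "G x"; cases "G y") auto
  qed (use uv in \<open>auto simp flip: zero_ereal_def one_ereal_def\<close>)
qed

lemma convex_funD:
  assumes "convex_fun G" "G x \<le> ereal a" "G y \<le> ereal b" "0 \<le> u" "0 \<le> v" "u + v = 1"
  shows "G (u *\<^sub>R x + v *\<^sub>R y) \<le> ereal (u * a + v * b)"
proof -
  have "G (u *\<^sub>R x + v *\<^sub>R y) \<le> ereal u * G x + ereal v * G y"
    using assms unfolding convex_fun_def by blast
  also have "\<dots> \<le> ereal u * ereal a + ereal v * ereal b"
    using assms by (intro add_mono ereal_mult_left_mono) auto
  finally show ?thesis by simp
qed

lemma lsc_fun_iff: "lsc_fun G \<longleftrightarrow> (\<forall>x. \<forall>c<G x. \<forall>\<^sub>F z in nhds x. c < G z)"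
  unfolding lsc_fun_def le_Liminf_iff eventually_nhds_conv_at by auto

lemma proper_convex_lscI:
  assumes "\<And>x. G x \<noteq> -\<infinity>" "G x0 \<noteq> \<infinity>" "convex_fun G" "lsc_fun G"
  shows "proper_convex_lsc G"
  using assms unfolding proper_convex_lsc_def proper_fun_def by auto

lemma proper_convex_lscD:
  assumes "proper_convex_lsc G"
  shows "G x \<noteq> -\<infinity>" "\<exists>x r. G x = ereal r" "convex_fun G" "lsc_fun G"
proof -
  show 1: "G x \<noteq> -\<infinity>" for x
    using assms unfolding proper_convex_lsc_def proper_fun_def by auto
  obtain x where "G x \<noteq> \<infinity>"
    using assms unfolding proper_convex_lsc_def proper_fun_def by auto
  then show "\<exists>x r. G x = ereal r" using 1[of x] by (cases "G x") auto
qed (use assms in \<open>auto simp: proper_convex_lsc_def\<close>)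

lemma proper_convex_lsc_scale:
  fixes G :: "'a::euclidean_space \<Rightarrow> ereal"
  assumes G: "proper_convex_lsc G" and c: "0 < c"
  shows "proper_convex_lsc (\<lambda>x. ereal c * G x)"
proof -
  note D = proper_convex_lscD[OF G]
  obtain x0 r where x0: "G x0 = ereal r" using D(2) by auto
  show ?thesis
  proof (rule proper_convex_lscI[where ?x0.0 = x0])
    show "ereal c * G x \<noteq> -\<infinity>" for x using D(1)[of x] c by (cases "G x") auto
    show "ereal c * G x0 \<noteq> \<infinity>" using x0 by simp
    show "convex_fun (\<lambda>x. ereal c * G x)"
    proof (rule convex_funI)
      show "ereal c * G x \<noteq> -\<infinity>" for x using D(1)[of x] c by (cases "G x") auto
      fix x y a b and u v :: real
      assume *: "ereal c * G x = ereal a" "ereal c * G y = ereal b" "0 < u" "0 < v" "u + v = 1"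
      have "G x = ereal (a / c)" "G y = ereal (b / c)"
        using * c D(1) by (cases "G x"; cases "G y"; force)+
      then have "G (u *\<^sub>R x + v *\<^sub>R y) \<le> ereal (u * (a / c) + v * (b / c))"
        using * by (intro convex_funD[OF D(3)]) auto
      then have "ereal c * G (u *\<^sub>R x + v *\<^sub>R y) \<le> ereal c * ereal (u * (a / c) + v * (b / c))"
        using c by (intro ereal_mult_left_mono) auto
      then show "ereal c * G (u *\<^sub>R x + v *\<^sub>R y) \<le> ereal (u * a + v * b)"
        using c by (simp add: distrib_left mult.left_commute)
    qed
    show "lsc_fun (\<lambda>x. ereal c * G x)"
      unfolding lsc_fun_def
    proof
      fix x
      have "ereal c * G x \<le> ereal c * Liminf (at x) G"
        using D(4) c unfolding lsc_fun_def by (intro ereal_mult_left_mono) auto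
      also have "\<dots> = Liminf (at x) (\<lambda>x. ereal c * G x)"
        using c by (intro Liminf_ereal_mult_left[symmetric]) auto
      finally show "ereal c * G x \<le> Liminf (at x) (\<lambda>x. ereal c * G x)" .
    qed
  qed
qed

lemma closed_epigraph:
  assumes "lsc_fun G"
  shows "closed {(z, t). G z \<le> ereal t}"
  unfolding closed_def
proof (rule open_prod_intro)
  fix w assume "w \<in> - {(z, t). G z \<le> ereal t}"
  then obtain z t where w: "w = (z, t)" and "ereal t < G z" by (cases w) (auto simp: not_le)
  then obtain c where c: "t < c" "ereal c < G z"
    using ereal_dense2 less_ereal.simps(1) by metis
  then obtain U where U: "open U" "z \<in> U" "\<And>u. u \<in> U \<Longrightarrow> ereal c < G u"
    using assms unfolding lsc_fun_iff eventually_nhds by metis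
  have "U \<times> {..<c} \<subseteq> - {(z, t). G z \<le> ereal t}"
  proof clarsimp
    fix u t' assume "u \<in> U" "t' < c" "G u \<le> ereal t'"
    then have "ereal t' < ereal t'" using U(3)[of u] by (auto dest: less_le_trans less_trans)
    then show False by simp
  qed
  then show "\<exists>A B. open A \<and> open B \<and> w \<in> A \<times> B \<and> A \<times> B \<subseteq> - {(z, t). G z \<le> ereal t}"
    using U c w by (intro exI[of _ U] exI[of _ "{..<c}"]) auto
qed

lemma convex_epigraph:
  assumes "convex_fun G"
  shows "convex {(z, t). G z \<le> ereal t}"
  by (rule convexI) (auto intro: convex_funD[OF assms])

lemma proper_convex_lsc_affine_minorant:
  fixes G :: "'a::euclidean_space \<Rightarrow> ereal"
  assumes G: "proper_convex_lsc G"
  obtains a b where "\<And>z. ereal (a \<bullet> z + b) \<le> G z"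
proof -
  note D = proper_convex_lscD[OF G]
  let ?E = "{(z, t). G z \<le> ereal t}"
  obtain x0 r where x0: "G x0 = ereal r" using D(2) by auto
  have "(x0, r - 1) \<notin> ?E" using x0 by simp
  then obtain w e where lt: "w \<bullet> (x0, r - 1) < e" and gt: "\<And>v. v \<in> ?E \<Longrightarrow> w \<bullet> v > e"
    using separating_hyperplane_closed_point[OF convex_epigraph[OF D(3)] closed_epigraph[OF D(4)]]
    by meson
  obtain a c where w: "w = (a, c)" by (cases w)
  have lt': "a \<bullet> x0 + c * (r - 1) < e" using lt w by simp
  have gt': "a \<bullet> z + c * t > e" if "G z \<le> ereal t" for z t
    using gt[of "(z, t)"] that w by simp
  have c: "c > 0" using lt' gt'[of x0 r] x0 by (simp add: algebra_simps)
  have "ereal ((- (1 / c) *\<^sub>R a) \<bullet> z + e / c) \<le> G z" for z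
  proof (cases "G z")
    case (real t)
    then show ?thesis using gt'[of z t] c by (simp add: field_simps)
  qed (use D(1)[of z] in auto)
  then show thesis by (rule that)
qed

lemma proper_convex_lsc_conjugate:
  fixes H :: "'a::euclidean_space \<Rightarrow> ereal"
  assumes H: "proper_convex_lsc H"
  shows "proper_convex_lsc (conjugate H)"
proof -
  note D = proper_convex_lscD[OF H]
  obtain x0 r where x0: "H x0 = ereal r" using D(2) by auto
  obtain a b where ab: "\<And>z. ereal (a \<bullet> z + b) \<le> H z"
    using proper_convex_lsc_affine_minorant[OF H] by blast
  have ge: "ereal (x \<bullet> y) - H x \<le> conjugate H y" for x y
    unfolding conjugate_def by (rule SUP_upper) simp
  have bot: "conjugate H y \<noteq> -\<infinity>" for y
    using ge[of x0 y] x0 by auto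
  show ?thesis
  proof (rule proper_convex_lscI[where ?x0.0 = a])
    show "conjugate H y \<noteq> -\<infinity>" for y by (rule bot)
    have "conjugate H a \<le> ereal (- b)"
      unfolding conjugate_def
    proof (rule SUP_least)
      fix x
      show "ereal (x \<bullet> a) - H x \<le> ereal (- b)"
        using ab[of x] by (cases "H x") (auto simp: inner_commute)
    qed
    then show "conjugate H a \<noteq> \<infinity>" by auto
    show "convex_fun (conjugate H)"
    proof (rule convex_funI[OF bot])
      fix y y' c d and u v :: real
      assume *: "conjugate H y = ereal c" "conjugate H y' = ereal d" "0 < u" "0 < v" "u + v = 1"
      show "conjugate H (u *\<^sub>R y + v *\<^sub>R y') \<le> ereal (u * c + v * d)"
        unfolding conjugate_def
      proof (rule SUP_least)
        fix x
        show "ereal (x \<bullet> (u *\<^sub>R y + v *\<^sub>R y')) - H x \<le> ereal (u * c + v * d)"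
        proof (cases "H x")
          case (real t)
          have "u * (x \<bullet> y - t) + v * (x \<bullet> y' - t) \<le> u * c + v * d"
            using ge[of x y] ge[of x y'] real * by (intro add_mono mult_left_mono) auto
          moreover have "t = u * t + v * t" using * by (simp flip: distrib_right)
          ultimately show ?thesis using real by (simp add: inner_add_right algebra_simps)
        qed (use D(1)[of x] in auto)
      qed
    qed
    show "lsc_fun (conjugate H)"
      unfolding lsc_fun_iff
    proof (intro allI impI)
      fix y c assume "c < conjugate H y"
      then obtain x where x: "c < ereal (x \<bullet> y) - H x"
        unfolding conjugate_def less_SUP_iff by auto
      then obtain t where t: "H x = ereal t"
        using D(1)[of x] by (cases "H x") auto
      have "((\<lambda>z. ereal (x \<bullet> z - t)) \<longlongrightarrow> ereal (x \<bullet> y - t)) (nhds y)"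
        by (intro tendsto_intros filterlim_ident)
      then have "\<forall>\<^sub>F z in nhds y. c < ereal (x \<bullet> z - t)"
        using x t by (intro order_tendstoD) auto
      then show "\<forall>\<^sub>F z in nhds y. c < conjugate H z"
        by eventually_elim (use ge[of x] t in \<open>auto intro: less_le_trans\<close>)
    qed
  qed
qed

lemma prox_minimizer_exists:
  fixes G :: "'a::euclidean_space \<Rightarrow> ereal"
  assumes G: "proper_convex_lsc G"
  obtains z where "\<And>u. G z + ereal ((norm (w - z))\<^sup>2 / 2) \<le> G u + ereal ((norm (w - u))\<^sup>2 / 2)"
proof -
  note D = proper_convex_lscD[OF G]
  let ?E = "{(z, t). G z \<le> ereal t}"
  let ?f = "\<lambda>v. snd v + (norm (w - fst v))\<^sup>2 / 2"
  obtain x0 r where x0: "G x0 = ereal r" using D(2) by auto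
  obtain a b where ab: "\<And>z. ereal (a \<bullet> z + b) \<le> G z"
    using proper_convex_lsc_affine_minorant[OF G] by blast
  \<comment> \<open>Minimizing the continuous real function \<open>?f\<close> over a compact part of the epigraph replaces an
    extreme value theorem for extended-valued lower semicontinuous functions.\<close>
  define m where "m = ?f (x0, r)"
  define K where "K = ?E \<inter> {v. ?f v \<le> m}"
  have "closed K" unfolding K_def
    by (intro closed_Int closed_epigraph D closed_Collect_le continuous_intros) auto
  moreover have "bounded K"
  proof -
    define C where "C = m - b - a \<bullet> w + (norm a)\<^sup>2"
    have "norm (w - z) \<le> 1 + 4 * \<bar>C\<bar> \<and> \<bar>t\<bar> \<le> \<bar>m\<bar> + \<bar>b\<bar> + norm a * (norm w + 1 + 4 * \<bar>C\<bar>)"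
      if "(z, t) \<in> K" for z t
    proof -
      have t1: "t + (norm (w - z))\<^sup>2 / 2 \<le> m" and t2: "a \<bullet> z + b \<le> t"
        using that ab[of z] unfolding K_def by (auto dest: order_trans)
      have "(norm (a - (1/2) *\<^sub>R d))\<^sup>2 = (norm a)\<^sup>2 - a \<bullet> d + (norm d)\<^sup>2 / 4" for d
        by (simp add: power2_norm_eq_inner inner_diff_left inner_diff_right inner_commute)
      then have "0 \<le> (norm a)\<^sup>2 - a \<bullet> (w - z) + (norm (w - z))\<^sup>2 / 4"
        by (metis zero_le_power2)
      then have "(norm (w - z))\<^sup>2 \<le> 4 * C"
        using t1 t2 unfolding C_def by (simp add: inner_diff_right)
      also have "4 * C \<le> (1 + 4 * \<bar>C\<bar>) * 1" by simp
      also have "\<dots> \<le> (1 + 4 * \<bar>C\<bar>)\<^sup>2"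
        unfolding power2_eq_square by (intro mult_left_mono) auto
      finally have n: "norm (w - z) \<le> 1 + 4 * \<bar>C\<bar>"
        by (rule power2_le_imp_le) simp
      have "norm z \<le> norm w + (1 + 4 * \<bar>C\<bar>)"
        using n norm_triangle_ineq4[of w "w - z"] by simp
      then have "\<bar>a \<bullet> z\<bar> \<le> norm a * (norm w + 1 + 4 * \<bar>C\<bar>)"
        by (intro order_trans[OF Cauchy_Schwarz_ineq2] mult_left_mono) auto
      moreover have "t \<le> m" using t1 zero_le_power2[of "norm (w - z)"] by linarith
      ultimately show ?thesis using n t2 by linarith
    qed
    then have "K \<subseteq> cball w (1 + 4 * \<bar>C\<bar>) \<times> cball 0 (\<bar>m\<bar> + \<bar>b\<bar> + norm a * (norm w + 1 + 4 * \<bar>C\<bar>))"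
      by (auto simp: dist_norm)
    then show ?thesis
      by (rule bounded_subset[rotated]) (intro bounded_Times bounded_cball)
  qed
  ultimately have "compact K" by (simp add: compact_eq_bounded_closed)
  moreover have "(x0, r) \<in> K" unfolding K_def m_def using x0 by auto
  ultimately obtain v where v: "v \<in> K" "\<And>v'. v' \<in> K \<Longrightarrow> ?f v \<le> ?f v'"
    using continuous_attains_inf[of K ?f] by (force intro: continuous_intros)
  obtain z t where zt: "v = (z, t)" by (cases v)
  have "G z + ereal ((norm (w - z))\<^sup>2 / 2) \<le> G u + ereal ((norm (w - u))\<^sup>2 / 2)" for u
  proof (cases "G u")
    case (real q)
    have "?f (z, t) \<le> ?f (u, q)"
    proof (cases "(u, q) \<in> K")
      case True
      then show ?thesis using v zt by blast
    next
      case False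
      then show ?thesis using real v zt unfolding K_def by auto
    qed
    moreover have "G z \<le> ereal t" using v zt unfolding K_def by auto
    ultimately show ?thesis using real by (cases "G z") auto
  qed (use D(1)[of u] in auto)
  then show thesis by (rule that)
qed

lemma prox_subdifferential:
  fixes G :: "'a::euclidean_space \<Rightarrow> ereal"
  assumes G: "proper_convex_lsc G"
  shows "w - prox G w \<in> subdifferential G (prox G w)" "\<exists>r. G (prox G w) = ereal r"
proof -
  note D = proper_convex_lscD[OF G]
  define z where "z = prox G w"
  obtain z' where "\<And>u. G z' + ereal ((norm (w - z'))\<^sup>2 / 2) \<le> G u + ereal ((norm (w - u))\<^sup>2 / 2)"
    using prox_minimizer_exists[OF G] by blast
  then have "is_arg_min (\<lambda>u. G u + ereal ((norm (w - u))\<^sup>2 / 2)) (\<lambda>_. True) z'"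
    by (simp add: is_arg_min_linorder)
  then have "is_arg_min (\<lambda>u. G u + ereal ((norm (w - u))\<^sup>2 / 2)) (\<lambda>_. True) z"
    unfolding z_def prox_def arg_min_def by (rule someI)
  then have z: "G z + ereal ((norm (w - z))\<^sup>2 / 2) \<le> G u + ereal ((norm (w - u))\<^sup>2 / 2)" for u
    by (simp add: is_arg_min_linorder)
  obtain x0 r0 where "G x0 = ereal r0" using D(2) by auto
  then obtain r where r: "G z = ereal r" using z[of x0] D(1)[of z] by (cases "G z") auto
  then show "\<exists>r. G (prox G w) = ereal r" unfolding z_def by auto
  have "G z + ereal ((w - z) \<bullet> (u - z)) \<le> G u" for u
  proof (cases "G u")
    case (real q)
    have *: "r + (w - z) \<bullet> (u - z) - q \<le> e * ((norm (u - z))\<^sup>2 / 2)" if e: "0 < e" "e < 1" for e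
    proof -
      let ?v = "(1 - e) *\<^sub>R z + e *\<^sub>R u"
      have "G ?v \<le> ereal ((1 - e) * r + e * q)"
        using e r real by (intro convex_funD[OF D(3)]) auto
      then have "ereal (r + (norm (w - z))\<^sup>2 / 2) \<le> ereal ((1 - e) * r + e * q + (norm (w - ?v))\<^sup>2 / 2)"
        using z[of ?v] r D(1)[of ?v] by (cases "G ?v") auto
      moreover have "w - ?v = (w - z) - e *\<^sub>R (u - z)" by (simp add: algebra_simps)
      then have "(norm (w - ?v))\<^sup>2 = (norm (w - z))\<^sup>2 - 2 * e * ((w - z) \<bullet> (u - z)) + e\<^sup>2 * (norm (u - z))\<^sup>2"
        by (simp only: power2_norm_eq_inner) (simp add: inner_diff_left inner_diff_right inner_commute power2_eq_square algebra_simps)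
      ultimately have "e * (r + (w - z) \<bullet> (u - z) - q) \<le> e * (e * ((norm (u - z))\<^sup>2 / 2))"
        by (simp add: algebra_simps power2_eq_square)
      then show ?thesis using e by simp
    qed
    have "((\<lambda>e. e * ((norm (u - z))\<^sup>2 / 2)) \<longlongrightarrow> 0 * ((norm (u - z))\<^sup>2 / 2)) (at_right (0::real))"
      by (intro tendsto_intros)
    moreover have "\<forall>\<^sub>F e in at_right 0. r + (w - z) \<bullet> (u - z) - q \<le> e * ((norm (u - z))\<^sup>2 / 2)"
      using * unfolding eventually_at_right_field by (intro exI[of _ 1]) auto
    ultimately have "r + (w - z) \<bullet> (u - z) - q \<le> 0 * ((norm (u - z))\<^sup>2 / 2)"
      by (rule tendsto_lowerbound) simp
    then show ?thesis using real r by simp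
  qed (use D(1)[of u] in auto)
  then show "w - prox G w \<in> subdifferential G (prox G w)"
    unfolding subdifferential_def z_def by blast
qed

lemma subdifferential_scale:
  assumes "0 < c" "g \<in> subdifferential (\<lambda>x. ereal c * G x) x"
  shows "(1 / c) *\<^sub>R g \<in> subdifferential G x"
  unfolding subdifferential_def
proof (intro CollectI allI)
  fix z
  have "ereal c * G x + ereal (g \<bullet> (z - x)) \<le> ereal c * G z"
    using assms unfolding subdifferential_def by auto
  then show "G x + ereal (((1 / c) *\<^sub>R g) \<bullet> (z - x)) \<le> G z"
    using assms(1) by (cases "G x"; cases "G z") (auto simp: field_simps)
qed

lemma prox_scale_subdifferential:
  fixes G :: "'a::euclidean_space \<Rightarrow> ereal"
  assumes "proper_convex_lsc G" "0 < c"
  shows "(1 / c) *\<^sub>R (w - prox (\<lambda>x. ereal c * G x) w) \<in> subdifferential G (prox (\<lambda>x. ereal c * G x) w)"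
  using subdifferential_scale prox_subdifferential(1)[OF proper_convex_lsc_scale] assms by blast

lemma subdifferential_finite:
  assumes "proper_convex_lsc G" "g \<in> subdifferential G x"
  obtains r where "G x = ereal r"
proof -
  obtain x0 r where "G x0 = ereal r" using proper_convex_lscD(2)[OF assms(1)] by auto
  moreover have "G x + ereal (g \<bullet> (x0 - x)) \<le> G x0" using assms(2) by (auto simp: subdifferential_def)
  ultimately show thesis
    using that proper_convex_lscD(1)[OF assms(1), of x] by (cases "G x") auto
qed

lemma bregman_le_inner:
  assumes G: "proper_convex_lsc G" and g: "g \<in> subdifferential G x" and g': "g' \<in> subdifferential G x'"
  shows "bregman G g' x x' \<le> ereal ((g - g') \<bullet> (x - x'))"
proof -
  obtain r r' where r: "G x = ereal r" "G x' = ereal r'" using subdifferential_finite[OF G] g g' by metis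
  have "G x + ereal (g \<bullet> (x' - x)) \<le> G x'" using g by (auto simp: subdifferential_def)
  then show ?thesis using r unfolding bregman_def by (simp add: inner_diff_left inner_diff_right)
qed

lemma bregman_nonneg:
  assumes G: "proper_convex_lsc G" and g': "g' \<in> subdifferential G x'"
  shows "0 \<le> bregman G g' x x'"
proof -
  obtain r' where r: "G x' = ereal r'" using subdifferential_finite[OF G] g' by metis
  have "G x' + ereal (g' \<bullet> (x - x')) \<le> G x" using g' by (auto simp: subdifferential_def)
  then show ?thesis using r unfolding bregman_def by (cases "G x") (auto simp: inner_diff_left inner_diff_right)
qed

lemma subdifferential_monotone:
  assumes G: "proper_convex_lsc G" and g: "g \<in> subdifferential G x" and g': "g' \<in> subdifferential G x'"
  shows "0 \<le> (g - g') \<bullet> (x - x')"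
  using bregman_nonneg[OF G g', of x] bregman_le_inner[OF assms]
  by (metis ereal_less_eq(5) order_trans)

lemma prox_nonexpansive:
  fixes G :: "'a::euclidean_space \<Rightarrow> ereal"
  assumes G: "proper_convex_lsc G"
  shows "norm (prox G w - prox G w') \<le> norm (w - w')"
proof -
  let ?d = "prox G w - prox G w'"
  have "0 \<le> ((w - prox G w) - (w' - prox G w')) \<bullet> ?d"
    by (intro subdifferential_monotone[OF G] prox_subdifferential G)
  then have "?d \<bullet> ?d \<le> (w - w') \<bullet> ?d" by (simp add: inner_diff_left inner_diff_right)
  also have "\<dots> \<le> norm (w - w') * norm ?d" by (rule norm_cauchy_schwarz)
  finally have "norm ?d * norm ?d \<le> norm (w - w') * norm ?d"
    by (simp flip: power2_norm_eq_inner add: power2_eq_square)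
  then show ?thesis by (cases "norm ?d = 0") auto
qed

lemma continuous_on_prox:
  fixes G :: "'a::euclidean_space \<Rightarrow> ereal"
  assumes "proper_convex_lsc G"
  shows "continuous_on UNIV (prox G)"
  by (rule lipschitz_on_continuous_on[of 1], rule lipschitz_onI)
    (use prox_nonexpansive[OF assms] in \<open>auto simp: dist_norm\<close>)

lemma bregman_mean_le:
  assumes G: "proper_convex_lsc G" and g': "g' \<in> subdifferential G x'"
    and S: "finite S" "S \<noteq> {}" and g: "\<And>i. i \<in> S \<Longrightarrow> g i \<in> subdifferential G (x i)"
  shows "bregman G g' ((1 / real (card S)) *\<^sub>R (\<Sum>i\<in>S. x i)) x'
    \<le> ereal ((1 / real (card S)) * (\<Sum>i\<in>S. (g i - g') \<bullet> (x i - x')))"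
proof -
  note D = proper_convex_lscD[OF G]
  let ?n = "1 / real (card S)" and ?G = "\<lambda>x. real_of_ereal (G x)"
  let ?C = "{x. \<bar>G x\<bar> \<noteq> \<infinity>}"
  let ?m = "?n *\<^sub>R (\<Sum>i\<in>S. x i)"
  have eq: "G x = ereal (?G x)" if "x \<in> ?C" for x using that by (cases "G x") auto
  have conv: "G (u *\<^sub>R x + v *\<^sub>R y) \<le> ereal (u * ?G x + v * ?G y)"
    if "x \<in> ?C" "y \<in> ?C" "0 \<le> u" "0 \<le> v" "u + v = 1" for x y u v
    using that eq by (intro convex_funD[OF D(3)]) auto
  have fin: "\<bar>G z\<bar> \<noteq> \<infinity>" if "G z \<le> ereal c" for z c using that D(1)[of z] by (cases "G z") auto
  have C: "convex ?C" by (intro convexI CollectI fin[OF conv]) auto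
  have cvx: "convex_on ?C ?G"
    unfolding convex_on_def
  proof (intro conjI C ballI allI impI)
    fix x y and u v :: real assume *: "x \<in> ?C" "y \<in> ?C" "0 \<le> u" "0 \<le> v" "u + v = 1"
    show "?G (u *\<^sub>R x + v *\<^sub>R y) \<le> u * ?G x + v * ?G y"
      using conv[OF *] fin[OF conv[OF *]] by (cases "G (u *\<^sub>R x + v *\<^sub>R y)") auto
  qed
  have xC: "x i \<in> ?C" if "i \<in> S" for i
    by (rule subdifferential_finite[OF G g[OF that]]) auto
  have J: "?G (\<Sum>i\<in>S. ?n *\<^sub>R x i) \<le> (\<Sum>i\<in>S. ?n * ?G (x i))"
    by (rule convex_on_sum[OF S cvx]) (use S xC in auto)
  have "(\<Sum>i\<in>S. ?n *\<^sub>R x i) \<in> ?C"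
    by (rule convex_sum[OF S(1) C]) (use S xC in auto)
  then have m: "?m \<in> ?C" by (simp add: scaleR_sum_right)
  have x': "x' \<in> ?C" by (rule subdifferential_finite[OF G g']) auto
  have "bregman G g' ?m x' = ereal (?G ?m - ?G x' - g' \<bullet> (?m - x'))"
    using m x' unfolding bregman_def by (cases "G ?m"; cases "G x'") auto
  also have "\<dots> \<le> ereal ((\<Sum>i\<in>S. ?n * ?G (x i)) - ?G x' - g' \<bullet> (?m - x'))"
    using J by (simp add: scaleR_sum_right)
  also have "(\<Sum>i\<in>S. ?n * ?G (x i)) - ?G x' - g' \<bullet> (?m - x')
      = (\<Sum>i\<in>S. ?n * (?G (x i) - ?G x' - g' \<bullet> (x i - x')))"
    using S by (simp add: sum_subtractf inner_diff_right inner_sum_right right_diff_distrib sum_distrib_left)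
  also have "\<dots> \<le> (\<Sum>i\<in>S. ?n * ((g i - g') \<bullet> (x i - x')))"
  proof (intro sum_mono mult_left_mono)
    fix i assume i: "i \<in> S"
    show "?G (x i) - ?G x' - g' \<bullet> (x i - x') \<le> (g i - g') \<bullet> (x i - x')"
      using bregman_le_inner[OF G g[OF i] g'] unfolding bregman_def
      using xC[OF i] x' by (cases "G (x i)"; cases "G x'") auto
  qed simp
  finally show ?thesis by (simp add: sum_distrib_left)
qed

section \<open>One step of the iteration\<close>

lemma norm_adjoint_le:
  fixes L :: "'a::euclidean_space \<Rightarrow> 'b::euclidean_space"
  assumes "linear L"
  shows "norm (adjoint L z) \<le> onorm L * norm z"
proof -
  let ?u = "adjoint L z"
  have "norm ?u * norm ?u = L ?u \<bullet> z"
    using adjoint_works[OF assms, of ?u z] by (simp flip: power2_norm_eq_inner add: power2_eq_square)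
  also have "\<dots> \<le> norm (L ?u) * norm z" by (rule norm_cauchy_schwarz)
  also have "\<dots> \<le> onorm L * norm ?u * norm z"
    using assms by (intro mult_right_mono onorm) (auto simp: linear_conv_bounded_linear)
  finally have "norm ?u * norm ?u \<le> norm ?u * (onorm L * norm z)" by (simp add: mult_ac)
  then show ?thesis
    using onorm_pos_le[of L] assms by (cases "?u = 0") (auto simp: linear_conv_bounded_linear)
qed

lemma dual_norm_nonneg:
  fixes L :: "'a::euclidean_space \<Rightarrow> 'b::euclidean_space"
  assumes "linear L" "0 < \<gamma>" "0 < \<tau>" "\<gamma> * \<tau> * (onorm L)\<^sup>2 \<le> 1"
  shows "0 \<le> \<gamma> / \<tau> * (norm z)\<^sup>2 - \<gamma>\<^sup>2 * (norm (adjoint L z))\<^sup>2"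
proof -
  have "(norm (adjoint L z))\<^sup>2 \<le> (onorm L)\<^sup>2 * (norm z)\<^sup>2"
    using power_mono[OF norm_adjoint_le[OF assms(1), of z], of 2] by (simp add: power_mult_distrib)
  then have "\<gamma>\<^sup>2 * (norm (adjoint L z))\<^sup>2 \<le> \<gamma>\<^sup>2 * ((onorm L)\<^sup>2 * (norm z)\<^sup>2)"
    by (intro mult_left_mono) auto
  also have "\<dots> = (\<gamma> * \<tau> * (onorm L)\<^sup>2) * (\<gamma> / \<tau> * (norm z)\<^sup>2)"
    using assms by (simp add: power2_eq_square)
  also have "\<dots> \<le> 1 * (\<gamma> / \<tau> * (norm z)\<^sup>2)"
    using assms by (intro mult_right_mono) auto
  finally show ?thesis by simp
qed

lemma norm_P_power2:
  fixes L :: "'a::euclidean_space \<Rightarrow> 'b::euclidean_space"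
  assumes "linear L" "0 < \<gamma>" "0 < \<tau>" "\<gamma> * \<tau> * (onorm L)\<^sup>2 \<le> 1"
  shows "(norm_P \<gamma> \<tau> L v)\<^sup>2
    = (norm (fst v))\<^sup>2 + \<gamma> / \<tau> * (norm (snd v))\<^sup>2 - \<gamma>\<^sup>2 * (norm (adjoint L (snd v)))\<^sup>2"
  using dual_norm_nonneg[OF assms, of "snd v"] unfolding norm_P_def
  by (subst real_sqrt_pow2) (auto simp: add_diff_eq[symmetric] simp del: add_diff_eq)

lemma primal_step_identity:
  fixes d :: "'a::real_inner"
  shows "(norm (d - c *\<^sub>R (e + f)))\<^sup>2 = (norm (d + c *\<^sub>R u))\<^sup>2 - 2 * c * (e \<bullet> d)
    - 2 * c * (f \<bullet> (d - c *\<^sub>R (u + e + f))) - 2 * c * (u \<bullet> d)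
    + c\<^sup>2 * (norm e)\<^sup>2 - c\<^sup>2 * (norm (f + u))\<^sup>2"
  unfolding power2_norm_eq_inner
  by (simp add: inner_add_left inner_add_right inner_diff_left inner_diff_right inner_commute
      power2_eq_square algebra_simps)

lemma dual_step_identity:
  fixes d u v :: "'a::real_inner" and y yp :: "'b::real_inner"
  assumes "c \<noteq> 0" "t \<noteq> 0"
  shows "c / t * (norm yp)\<^sup>2 - c\<^sup>2 * (norm u)\<^sup>2 = c / t * (norm y)\<^sup>2 - c\<^sup>2 * (norm v)\<^sup>2 + 2 * c * (u \<bullet> d)
    - 2 * c * ((1 / t) * ((y - yp) \<bullet> yp) + (d + c *\<^sub>R (u - v)) \<bullet> u)
    - (c / t * (norm (yp - y))\<^sup>2 - c\<^sup>2 * (norm (u - v))\<^sup>2)"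
  using assms unfolding power2_norm_eq_inner
  by (simp add: inner_add_left inner_add_right inner_diff_left inner_diff_right inner_commute
      power2_eq_square field_simps)

lemma PDDY_step:
  fixes L :: "'a::euclidean_space \<Rightarrow> 'b::euclidean_space"
  assumes L: "linear L" and \<gamma>: "0 < \<gamma>" and \<tau>: "0 < \<tau>" and "\<gamma> * \<tau> * (onorm L)\<^sup>2 \<le> 1"
    and opt: "gs + rs + adjoint L ys = 0"
    and w: "w = y + \<tau> *\<^sub>R L (p - \<gamma> *\<^sub>R adjoint L y)"
    and x: "x = p - \<gamma> *\<^sub>R adjoint L yp"
    and z: "z = 2 *\<^sub>R x - p - \<gamma> *\<^sub>R g"
    and pp: "pp = p + sp - x"
    and h: "h = (1 / \<tau>) *\<^sub>R (w - yp)" and r: "r = (1 / \<gamma>) *\<^sub>R (z - sp)"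
  shows "(norm_P \<gamma> \<tau> L ((pp, yp) - (xs + \<gamma> *\<^sub>R adjoint L ys, ys)))\<^sup>2
    \<le> (norm_P \<gamma> \<tau> L ((p, y) - (xs + \<gamma> *\<^sub>R adjoint L ys, ys)))\<^sup>2
      - 2 * \<gamma> * ((g - gs) \<bullet> (x - xs)) - 2 * \<gamma> * ((r - rs) \<bullet> (sp - xs))
      - 2 * \<gamma> * ((h - L xs) \<bullet> (yp - ys)) + \<gamma>\<^sup>2 * (norm (g - gs))\<^sup>2"
proof -
  let ?A = "adjoint L"
  interpret A: linear ?A by (rule adjoint_linear[OF L])
  interpret L: linear L by (rule L)
  define d u v e f where defs: "d = x - xs" "u = ?A (yp - ys)" "v = ?A (y - ys)" "e = g - gs" "f = r - rs"
  have d: "p - (xs + \<gamma> *\<^sub>R ?A ys) = d + \<gamma> *\<^sub>R u"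
    unfolding defs x by (simp add: A.diff algebra_simps)
  have sp: "sp = z - \<gamma> *\<^sub>R r" using \<gamma> unfolding r by simp
  have g: "gs = - rs - ?A ys" using opt by (simp add: eq_neg_iff_add_eq_0 algebra_simps)
  have z': "z = x - \<gamma> *\<^sub>R ?A yp - \<gamma> *\<^sub>R g" unfolding z x by (simp add: scaleR_2)
  have s: "sp - xs = d - \<gamma> *\<^sub>R (u + e + f)"
    unfolding sp z' defs g by (simp add: x A.diff algebra_simps)
  have "pp - (xs + \<gamma> *\<^sub>R ?A ys) = (sp - xs) + \<gamma> *\<^sub>R u"
    unfolding pp defs by (simp add: x A.diff algebra_simps)
  then have pd: "pp - (xs + \<gamma> *\<^sub>R ?A ys) = d - \<gamma> *\<^sub>R (e + f)"
    unfolding s by (simp add: algebra_simps)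
  have 1: "(norm (pp - (xs + \<gamma> *\<^sub>R ?A ys)))\<^sup>2 \<le> (norm (p - (xs + \<gamma> *\<^sub>R ?A ys)))\<^sup>2
      - 2 * \<gamma> * (e \<bullet> d) - 2 * \<gamma> * (f \<bullet> (sp - xs)) - 2 * \<gamma> * (u \<bullet> d) + \<gamma>\<^sup>2 * (norm e)\<^sup>2"
    unfolding pd d s primal_step_identity[of d \<gamma> e f u] by simp
  have "p - \<gamma> *\<^sub>R ?A y - xs = d + \<gamma> *\<^sub>R (u - v)"
    unfolding defs x by (simp add: A.diff algebra_simps)
  then have "L (p - \<gamma> *\<^sub>R ?A y) - L xs = L (d + \<gamma> *\<^sub>R (u - v))" by (simp flip: L.diff)
  moreover have "h = (1 / \<tau>) *\<^sub>R (y - yp) + L (p - \<gamma> *\<^sub>R ?A y)"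
    using \<tau> unfolding h w by (simp add: algebra_simps)
  ultimately have "h - L xs = (1 / \<tau>) *\<^sub>R ((y - ys) - (yp - ys)) + L (d + \<gamma> *\<^sub>R (u - v))"
    by (simp add: algebra_simps)
  then have hi: "(h - L xs) \<bullet> (yp - ys)
      = (1 / \<tau>) * (((y - ys) - (yp - ys)) \<bullet> (yp - ys)) + (d + \<gamma> *\<^sub>R (u - v)) \<bullet> u"
    unfolding defs(2) by (simp only: inner_add_left inner_scaleR_left adjoint_works[OF L])
  have "u - v = ?A ((yp - ys) - (y - ys))" unfolding defs by (simp only: A.diff)
  then have "0 \<le> \<gamma> / \<tau> * (norm ((yp - ys) - (y - ys)))\<^sup>2 - \<gamma>\<^sup>2 * (norm (u - v))\<^sup>2"
    using dual_norm_nonneg[OF assms(1-4)] by simp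
  then have 2: "\<gamma> / \<tau> * (norm (yp - ys))\<^sup>2 - \<gamma>\<^sup>2 * (norm u)\<^sup>2
      \<le> \<gamma> / \<tau> * (norm (y - ys))\<^sup>2 - \<gamma>\<^sup>2 * (norm v)\<^sup>2 + 2 * \<gamma> * (u \<bullet> d) - 2 * \<gamma> * ((h - L xs) \<bullet> (yp - ys))"
    using dual_step_identity[of \<gamma> \<tau> "yp - ys" u "y - ys" v d] \<gamma> \<tau> unfolding hi by linarith
  show ?thesis
    unfolding norm_P_power2[OF assms(1-4)] diff_Pair fst_conv snd_conv
    using 1 2 unfolding defs by linarith
qed

section \<open>Convex smooth functions\<close>

lemma convex_smooth_continuous:
  assumes "convex_smooth \<nu> F gradF"
  shows "continuous_on UNIV F"
  using assms unfolding convex_smooth_def gderiv_def by (intro has_derivative_continuous_on) auto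

lemma convex_smooth_tangent:
  assumes F: "convex_smooth \<nu> F gradF"
  shows "F x + gradF x \<bullet> (y - x) \<le> F y"
proof -
  let ?l = "\<lambda>t. x + t *\<^sub>R (y - x)"
  have "convex_on UNIV (\<lambda>t. F (?l t))"
    unfolding convex_on_def
  proof (intro conjI convex_UNIV ballI allI impI)
    fix s t u v :: real assume uv: "0 \<le> u" "0 \<le> v" "u + v = 1"
    have "?l (u *\<^sub>R s + v *\<^sub>R t) = (u + v) *\<^sub>R x + (u * s + v * t) *\<^sub>R (y - x)" using uv by simp
    also have "\<dots> = u *\<^sub>R ?l s + v *\<^sub>R ?l t" by (simp add: algebra_simps)
    finally show "F (?l (u *\<^sub>R s + v *\<^sub>R t)) \<le> u * F (?l s) + v * F (?l t)"
      using F uv unfolding convex_smooth_def convex_on_def by auto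
  qed
  moreover have "((\<lambda>t. F (?l t)) has_real_derivative gradF x \<bullet> (y - x)) (at 0)"
  proof -
    have "(F has_derivative (\<lambda>h. h \<bullet> gradF x)) (at (?l 0))"
      using F unfolding convex_smooth_def gderiv_def by simp
    moreover have "(?l has_derivative (\<lambda>t. t *\<^sub>R (y - x))) (at 0)"
      by (auto intro!: derivative_eq_intros)
    ultimately have "((\<lambda>t. F (?l t)) has_derivative (\<lambda>t. (t *\<^sub>R (y - x)) \<bullet> gradF x)) (at 0)"
      by (rule has_derivative_compose[rotated])
    moreover have "(\<lambda>t. (t *\<^sub>R (y - x)) \<bullet> gradF x) = (*) (gradF x \<bullet> (y - x))"
      by (auto simp: inner_commute)
    ultimately show ?thesis unfolding has_field_derivative_def by simp
  qed
  ultimately have "F (?l 1) - F (?l 0) \<ge> (gradF x \<bullet> (y - x)) * (1 - 0)"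
    by (intro convex_on_imp_above_tangent) auto
  then show ?thesis by simp
qed

lemma bregman_smooth_nonneg:
  assumes "convex_smooth \<nu> F gradF"
  shows "0 \<le> bregman_smooth F gradF x x'"
  using convex_smooth_tangent[OF assms, of x' x] unfolding bregman_smooth_def by simp

lemma bregman_smooth_le_inner:
  assumes "convex_smooth \<nu> F gradF"
  shows "bregman_smooth F gradF x x' \<le> (gradF x - gradF x') \<bullet> (x - x')"
  using convex_smooth_tangent[OF assms, of x x'] unfolding bregman_smooth_def
  by (simp add: inner_diff_left inner_diff_right)

lemma bregman_smooth_mean_le:
  assumes F: "convex_smooth \<nu> F gradF" and S: "finite S" "S \<noteq> {}"
  shows "bregman_smooth F gradF ((1 / real (card S)) *\<^sub>R (\<Sum>i\<in>S. x i)) x'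
    \<le> (1 / real (card S)) * (\<Sum>i\<in>S. bregman_smooth F gradF (x i) x')"
proof -
  let ?n = "1 / real (card S)"
  let ?m = "?n *\<^sub>R (\<Sum>i\<in>S. x i)"
  have "F (\<Sum>i\<in>S. ?n *\<^sub>R x i) \<le> (\<Sum>i\<in>S. ?n * F (x i))"
    using F by (intro convex_on_sum[OF S]) (use S in \<open>auto simp: convex_smooth_def\<close>)
  then have "bregman_smooth F gradF ?m x' \<le> (\<Sum>i\<in>S. ?n * F (x i)) - F x' - gradF x' \<bullet> (?m - x')"
    unfolding bregman_smooth_def by (simp add: scaleR_sum_right)
  also have "\<dots> = ?n * (\<Sum>i\<in>S. bregman_smooth F gradF (x i) x')"
    unfolding bregman_smooth_def using S
    by (simp add: sum_subtractf inner_diff_right inner_sum_right right_diff_distrib sum_distrib_left)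
  finally show ?thesis .
qed

section \<open>Square-integrable random vectors\<close>

definition square_integrable :: "'w measure \<Rightarrow> ('w \<Rightarrow> 'a::euclidean_space) \<Rightarrow> bool" where
  "square_integrable M f \<longleftrightarrow> f \<in> borel_measurable M \<and> integrable M (\<lambda>\<omega>. (norm (f \<omega>))\<^sup>2)"

lemma square_integrable_measurable:
  "square_integrable M f \<Longrightarrow> f \<in> borel_measurable M"
  unfolding square_integrable_def by simp

lemma square_integrable_bound:
  assumes "square_integrable M g" and [measurable]: "f \<in> borel_measurable M"
    and le: "\<And>\<omega>. \<omega> \<in> space M \<Longrightarrow> norm (f \<omega>) \<le> c * norm (g \<omega>)"
  shows "square_integrable M f"
  unfolding square_integrable_def
proof
  have "integrable M (\<lambda>\<omega>. c\<^sup>2 * (norm (g \<omega>))\<^sup>2)"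
    using assms(1) by (simp add: square_integrable_def)
  then show "integrable M (\<lambda>\<omega>. (norm (f \<omega>))\<^sup>2)"
  proof (rule Bochner_Integration.integrable_bound)
    show "AE \<omega> in M. norm ((norm (f \<omega>))\<^sup>2) \<le> norm (c\<^sup>2 * (norm (g \<omega>))\<^sup>2)"
      using power_mono[OF le, of _ 2] by (intro AE_I2) (auto simp: power_mult_distrib)
  qed simp
qed simp

lemma square_integrable_cong:
  assumes "\<And>\<omega>. \<omega> \<in> space M \<Longrightarrow> f \<omega> = g \<omega>"
  shows "square_integrable M f \<longleftrightarrow> square_integrable M g"
  unfolding square_integrable_def
  using measurable_cong[of M f g borel] Bochner_Integration.integrable_cong[of M M "\<lambda>\<omega>. (norm (f \<omega>))\<^sup>2" "\<lambda>\<omega>. (norm (g \<omega>))\<^sup>2"] assms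
  by auto

lemma square_integrable_const:
  assumes "finite_measure M"
  shows "square_integrable M (\<lambda>\<omega>. c)"
  using assms unfolding square_integrable_def by (simp add: finite_measure.integrable_const)

lemma square_integrable_add:
  assumes f: "square_integrable M f" and g: "square_integrable M g"
  shows "square_integrable M (\<lambda>\<omega>. f \<omega> + g \<omega>)"
proof -
  note [measurable] = f[THEN square_integrable_measurable] g[THEN square_integrable_measurable]
  have "integrable M (\<lambda>\<omega>. 2 * (norm (f \<omega>))\<^sup>2 + 2 * (norm (g \<omega>))\<^sup>2)"
    using f g by (simp add: square_integrable_def)
  then have "integrable M (\<lambda>\<omega>. (norm (f \<omega> + g \<omega>))\<^sup>2)"
  proof (rule Bochner_Integration.integrable_bound)
    have "(norm (a + b))\<^sup>2 \<le> 2 * (norm a)\<^sup>2 + 2 * (norm b)\<^sup>2" for a b :: 'b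
    proof -
      have "(norm (a + b))\<^sup>2 \<le> (norm a + norm b)\<^sup>2" by (intro power_mono norm_triangle_ineq) simp
      also have "\<dots> \<le> 2 * (norm a)\<^sup>2 + 2 * (norm b)\<^sup>2"
        using sum_squares_bound[of "norm a" "norm b"] by (simp add: power2_sum)
      finally show ?thesis .
    qed
    then show "AE \<omega> in M. norm ((norm (f \<omega> + g \<omega>))\<^sup>2) \<le> norm (2 * (norm (f \<omega>))\<^sup>2 + 2 * (norm (g \<omega>))\<^sup>2)"
      by (intro AE_I2) auto
  qed simp
  then show ?thesis unfolding square_integrable_def by simp
qed

lemma measurable_linear_comp:
  fixes T :: "'a::euclidean_space \<Rightarrow> 'b::euclidean_space"
  assumes "linear T" "f \<in> borel_measurable N"
  shows "(\<lambda>\<omega>. T (f \<omega>)) \<in> borel_measurable N"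
  using assms by (intro measurable_compose[OF assms(2) borel_measurable_continuous_onI]
      linear_continuous_on) (auto simp: linear_conv_bounded_linear)

lemma square_integrable_linear:
  fixes T :: "'a::euclidean_space \<Rightarrow> 'b::euclidean_space"
  assumes "linear T" "square_integrable M f"
  shows "square_integrable M (\<lambda>\<omega>. T (f \<omega>))"
proof (rule square_integrable_bound[OF assms(2)])
  show "(\<lambda>\<omega>. T (f \<omega>)) \<in> borel_measurable M"
    by (rule measurable_linear_comp[OF assms(1) square_integrable_measurable[OF assms(2)]])
  show "norm (T (f \<omega>)) \<le> onorm T * norm (f \<omega>)" for \<omega>
    using assms by (intro onorm) (simp add: linear_conv_bounded_linear)
qed

lemma square_integrable_scaleR:
  "square_integrable M f \<Longrightarrow> square_integrable M (\<lambda>\<omega>. c *\<^sub>R f \<omega>)"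
  by (rule square_integrable_linear) (rule linear_scale_self)

lemma square_integrable_diff:
  assumes "square_integrable M f" "square_integrable M g"
  shows "square_integrable M (\<lambda>\<omega>. f \<omega> - g \<omega>)"
  using square_integrable_add[OF assms(1) square_integrable_scaleR[OF assms(2), of "-1"]] by simp

lemma square_integrable_lipschitz:
  fixes T :: "'a::euclidean_space \<Rightarrow> 'b::euclidean_space"
  assumes "finite_measure M" "C-lipschitz_on UNIV T" "square_integrable M f"
  shows "square_integrable M (\<lambda>\<omega>. T (f \<omega>))"
proof -
  have m: "(\<lambda>\<omega>. T (f \<omega>)) \<in> borel_measurable M"
    using assms by (intro measurable_compose[OF square_integrable_measurable borel_measurable_continuous_onI]
        lipschitz_on_continuous_on)
  have "square_integrable M (\<lambda>\<omega>. T (f \<omega>) - T 0)"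
  proof (rule square_integrable_bound[OF assms(3)])
    show "norm (T (f \<omega>) - T 0) \<le> C * norm (f \<omega>)" for \<omega>
      using lipschitz_onD[OF assms(2), of "f \<omega>" 0] by (simp add: dist_norm)
  qed (use m in measurable)
  from square_integrable_add[OF this square_integrable_const[OF assms(1), of "T 0"]]
  show ?thesis by simp
qed

lemma square_integrable_inner:
  assumes f: "square_integrable M f" and g: "square_integrable M g"
  shows "integrable M (\<lambda>\<omega>. f \<omega> \<bullet> g \<omega>)"
proof (rule Bochner_Integration.integrable_bound)
  note [measurable] = f[THEN square_integrable_measurable] g[THEN square_integrable_measurable]
  show "integrable M (\<lambda>\<omega>. (norm (f \<omega>))\<^sup>2 + (norm (g \<omega>))\<^sup>2)"
    using f g by (simp add: square_integrable_def)
  show "(\<lambda>\<omega>. f \<omega> \<bullet> g \<omega>) \<in> borel_measurable M" by measurable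
  have "\<bar>a \<bullet> b\<bar> \<le> (norm a)\<^sup>2 + (norm b)\<^sup>2" for a b :: 'b
    using Cauchy_Schwarz_ineq2[of a b] sum_squares_bound[of "norm a" "norm b"]
      mult_nonneg_nonneg[of "norm a" "norm b"] by simp
  then show "AE \<omega> in M. norm (f \<omega> \<bullet> g \<omega>) \<le> norm ((norm (f \<omega>))\<^sup>2 + (norm (g \<omega>))\<^sup>2)"
    by (intro AE_I2) auto
qed

lemma (in sigma_finite_subalgebra) integral_le_of_nn_cond_exp_le:
  fixes f h :: "'a \<Rightarrow> real"
  assumes [measurable]: "f \<in> borel_measurable M" and "\<And>\<omega>. 0 \<le> f \<omega>"
    and h: "integrable M h" "\<And>\<omega>. 0 \<le> h \<omega>"
    and le: "AE \<omega> in M. nn_cond_exp M F (\<lambda>\<omega>. ennreal (f \<omega>)) \<omega> \<le> ennreal (h \<omega>)"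
  shows "integrable M f" "(\<integral>\<omega>. f \<omega> \<partial>M) \<le> (\<integral>\<omega>. h \<omega> \<partial>M)"
proof -
  have "(\<integral>\<^sup>+\<omega>. ennreal (f \<omega>) \<partial>M) = (\<integral>\<^sup>+\<omega>. nn_cond_exp M F (\<lambda>\<omega>. ennreal (f \<omega>)) \<omega> \<partial>M)"
    using nn_cond_exp_intg[of "\<lambda>_. 1" "\<lambda>\<omega>. ennreal (f \<omega>)"] by simp
  also have "\<dots> \<le> (\<integral>\<^sup>+\<omega>. ennreal (h \<omega>) \<partial>M)" by (rule nn_integral_mono_AE[OF le])
  also have "\<dots> = ennreal (\<integral>\<omega>. h \<omega> \<partial>M)" using h by (intro nn_integral_eq_integral) auto
  finally have *: "(\<integral>\<^sup>+\<omega>. ennreal (f \<omega>) \<partial>M) \<le> ennreal (\<integral>\<omega>. h \<omega> \<partial>M)" .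
  then show int: "integrable M f"
    using assms(2) by (intro integrableI_nonneg) (auto simp: le_less_trans[OF _ ennreal_less_top])
  have "0 \<le> (\<integral>\<omega>. h \<omega> \<partial>M)" using h by simp
  then show "(\<integral>\<omega>. f \<omega> \<partial>M) \<le> (\<integral>\<omega>. h \<omega> \<partial>M)"
    using * assms(2) int by (simp add: nn_integral_eq_integral)
qed

lemma (in sigma_finite_subalgebra) integral_inner_vec_cond_exp:
  fixes f h X :: "'a \<Rightarrow> 'b::euclidean_space"
  assumes f: "square_integrable M f" and X: "square_integrable M X" "X \<in> borel_measurable F"
    and h: "AE \<omega> in M. vec_cond_exp M F f \<omega> = h \<omega>" "h \<in> borel_measurable M"
  shows "(\<integral>\<omega>. h \<omega> \<bullet> X \<omega> \<partial>M) = (\<integral>\<omega>. f \<omega> \<bullet> X \<omega> \<partial>M)"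
proof -
  note [measurable] = f[THEN square_integrable_measurable] X(1)[THEN square_integrable_measurable] X(2) h(2)
  let ?E = "\<lambda>b. real_cond_exp M F (\<lambda>\<omega>. f \<omega> \<bullet> b)"
  have int: "integrable M (\<lambda>\<omega>. (X \<omega> \<bullet> b) * (f \<omega> \<bullet> b))" for b
  proof (rule Bochner_Integration.integrable_bound[OF integrable_mult_right[of "(norm b)\<^sup>2" M "\<lambda>\<omega>. (norm (X \<omega>))\<^sup>2 + (norm (f \<omega>))\<^sup>2"]])
    show "integrable M (\<lambda>\<omega>. (norm (X \<omega>))\<^sup>2 + (norm (f \<omega>))\<^sup>2)"
      using f X by (simp add: square_integrable_def)
    have "\<bar>(u \<bullet> b) * (v \<bullet> b)\<bar> \<le> (norm b)\<^sup>2 * ((norm u)\<^sup>2 + (norm v)\<^sup>2)" for u v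
    proof -
      have "\<bar>(u \<bullet> b) * (v \<bullet> b)\<bar> \<le> (norm u * norm b) * (norm v * norm b)"
        unfolding abs_mult by (intro mult_mono Cauchy_Schwarz_ineq2) auto
      also have "\<dots> = (norm b)\<^sup>2 * (norm u * norm v)" by (simp add: power2_eq_square)
      also have "\<dots> \<le> (norm b)\<^sup>2 * ((norm u)\<^sup>2 + (norm v)\<^sup>2)"
        using sum_squares_bound[of "norm u" "norm v"] mult_nonneg_nonneg[of "norm u" "norm v"]
        by (intro mult_left_mono) (simp_all del: mult_nonneg_nonneg)
      finally show ?thesis .
    qed
    then show "AE \<omega> in M. norm ((X \<omega> \<bullet> b) * (f \<omega> \<bullet> b)) \<le> norm ((norm b)\<^sup>2 * ((norm (X \<omega>))\<^sup>2 + (norm (f \<omega>))\<^sup>2))"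
      by (intro AE_I2) auto
  qed measurable
  have "(\<integral>\<omega>. h \<omega> \<bullet> X \<omega> \<partial>M) = (\<integral>\<omega>. vec_cond_exp M F f \<omega> \<bullet> X \<omega> \<partial>M)"
  proof (rule integral_cong_AE)
    show "(\<lambda>\<omega>. vec_cond_exp M F f \<omega> \<bullet> X \<omega>) \<in> borel_measurable M"
      unfolding vec_cond_exp_def
      by (intro borel_measurable_inner borel_measurable_sum borel_measurable_scaleR) auto
  qed (use h in auto)
  also have "\<dots> = (\<integral>\<omega>. (\<Sum>b\<in>Basis. (X \<omega> \<bullet> b) * ?E b \<omega>) \<partial>M)"
    by (simp add: vec_cond_exp_def inner_sum_left inner_commute[of "X _"] mult.commute)
  also have "\<dots> = (\<Sum>b\<in>Basis. \<integral>\<omega>. (X \<omega> \<bullet> b) * ?E b \<omega> \<partial>M)"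
    by (intro Bochner_Integration.integral_sum real_cond_exp_intg(1) int) auto
  also have "\<dots> = (\<Sum>b\<in>Basis. \<integral>\<omega>. (X \<omega> \<bullet> b) * (f \<omega> \<bullet> b) \<partial>M)"
    by (intro sum.cong refl real_cond_exp_intg(2) int) auto
  also have "\<dots> = (\<integral>\<omega>. (\<Sum>b\<in>Basis. (X \<omega> \<bullet> b) * (f \<omega> \<bullet> b)) \<partial>M)"
    by (intro Bochner_Integration.integral_sum[symmetric] int)
  also have "\<dots> = (\<integral>\<omega>. f \<omega> \<bullet> X \<omega> \<partial>M)"
    by (simp add: euclidean_inner[of "f _" "X _"] mult.commute)
  finally show ?thesis .
qed

section \<open>The Lyapunov function of the stochastic iteration\<close>

locale stochastic_PDDY_iteration =
  fixes M :: "'w measure" and \<FF> :: "nat \<Rightarrow> 'w measure"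
    and L :: "'a::euclidean_space \<Rightarrow> 'b::euclidean_space"
    and F :: "'a \<Rightarrow> real" and gradF :: "'a \<Rightarrow> 'a"
    and R :: "'a \<Rightarrow> ereal" and H :: "'b \<Rightarrow> ereal"
    and xs rs :: 'a and ys hs :: 'b and p0 :: 'a and y0 :: 'b
    and g p x s :: "nat \<Rightarrow> 'w \<Rightarrow> 'a" and y :: "nat \<Rightarrow> 'w \<Rightarrow> 'b"
    and \<sigma> :: "nat \<Rightarrow> 'w \<Rightarrow> real"
    and \<nu> \<gamma> \<tau> \<alpha> \<beta> \<delta> \<rho> \<sigma>0 :: real
  assumes L: "linear L"
    and F: "convex_smooth \<nu> F gradF"
    and R: "proper_convex_lsc R"
    and H: "proper_convex_lsc H"
    and rs: "rs \<in> subdifferential R xs"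
    and hs: "hs \<in> subdifferential (conjugate H) ys"
    and primal: "gradF xs + rs + adjoint L ys = 0"
    and dual: "hs = L xs"
    and prob: "prob_space M"
    and filtration: "filtration (space M) \<FF>"
    and subalg: "\<And>j. subalgebra M (\<FF> j)"
    and \<gamma>: "0 < \<gamma>" and \<tau>: "0 < \<tau>"
    and PDDY: "stochastic_PDDY (space M) \<gamma> \<tau> L R H g p0 y0 p y x s"
    and SGA: "stochastic_gradient_assumption M \<FF> F gradF xs x g \<sigma> \<alpha> \<beta> \<delta> \<rho>"
    and \<sigma>0: "\<And>\<omega>. \<omega> \<in> space M \<Longrightarrow> \<sigma> 0 \<omega> = \<sigma>0"
    and step_bound: "\<gamma> * (\<alpha> + \<beta> / \<rho> * \<delta>) \<le> 1 / 2"
    and step_product: "\<gamma> * \<tau> * (onorm L)\<^sup>2 \<le> 1"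
begin

abbreviation "A \<equiv> adjoint L"
abbreviation "H' \<equiv> conjugate H"
abbreviation "D k \<omega> \<equiv> bregman_smooth F gradF (x k \<omega>) xs"
abbreviation "y_arg k \<omega> \<equiv> y k \<omega> + \<tau> *\<^sub>R L (p k \<omega> - \<gamma> *\<^sub>R A (y k \<omega>))"
abbreviation "s_arg k \<omega> \<equiv> 2 *\<^sub>R x k \<omega> - p k \<omega> - \<gamma> *\<^sub>R g (Suc k) \<omega>"

definition "h k \<omega> = (1 / \<tau>) *\<^sub>R (y_arg k \<omega> - y (Suc k) \<omega>)"
definition "r k \<omega> = (1 / \<gamma>) *\<^sub>R (s_arg k \<omega> - s (Suc k) \<omega>)"

text \<open>These real-valued gaps dominate the Bregman divergences of \<^term>\<open>H'\<close> and \<^term>\<open>R\<close> at the iterates.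
  They are continuous in the iterates, so measurability of \<^term>\<open>H'\<close> and \<^term>\<open>R\<close> is never an issue.\<close>

definition "dual_gap k \<omega> = (h k \<omega> - hs) \<bullet> (y (Suc k) \<omega> - ys)"
definition "primal_gap k \<omega> = (r k \<omega> - rs) \<bullet> (s (Suc k) \<omega> - xs)"

definition "V k \<omega> = (norm_P \<gamma> \<tau> L ((p k \<omega>, y k \<omega>) - (xs + \<gamma> *\<^sub>R A ys, ys)))\<^sup>2
  + \<gamma>\<^sup>2 * (\<beta> / \<rho>) * (\<sigma> k \<omega>)\<^sup>2"

sublocale prob_space M by (rule prob)

lemma subalgebra_F: "sigma_finite_subalgebra M (\<FF> k)"
proof -
  interpret finite_measure_subalgebra M "\<FF> k" by unfold_locales (rule subalg)
  show ?thesis by (rule sigma_finite_subalgebra_axioms)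
qed

lemma space_F: "space (\<FF> k) = space M"
  using subalg[of k] by (simp add: subalgebra_def)

lemma PDDY_D:
  assumes "\<omega> \<in> space M"
  shows "p 0 \<omega> = p0" "y 0 \<omega> = y0"
    and "y (Suc k) \<omega> = prox (\<lambda>z. ereal \<tau> * H' z) (y_arg k \<omega>)"
    and "x k \<omega> = p k \<omega> - \<gamma> *\<^sub>R A (y (Suc k) \<omega>)"
    and "s (Suc k) \<omega> = prox (\<lambda>z. ereal \<gamma> * R z) (s_arg k \<omega>)"
    and "p (Suc k) \<omega> = p k \<omega> + s (Suc k) \<omega> - x k \<omega>"
  using PDDY assms unfolding stochastic_PDDY_def by auto

lemma H': "proper_convex_lsc H'"
  by (rule proper_convex_lsc_conjugate[OF H])

lemma subgradients:
  assumes "\<omega> \<in> space M"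
  shows "h k \<omega> \<in> subdifferential H' (y (Suc k) \<omega>)" "r k \<omega> \<in> subdifferential R (s (Suc k) \<omega>)"
  unfolding h_def r_def PDDY_D(3,5)[OF assms]
  by (rule prox_scale_subdifferential[OF H' \<tau>], rule prox_scale_subdifferential[OF R \<gamma>])

lemma gaps_nonneg:
  assumes "\<omega> \<in> space M"
  shows "0 \<le> dual_gap k \<omega>" "0 \<le> primal_gap k \<omega>"
  unfolding dual_gap_def primal_gap_def
  by (rule subdifferential_monotone[OF H' _ hs] subdifferential_monotone[OF R _ rs] subgradients assms)+

lemma D_nonneg: "0 \<le> D k \<omega>"
  by (rule bregman_smooth_nonneg[OF F])

lemma SGA_D:
  shows "0 \<le> \<alpha>" "0 \<le> \<beta>" "0 \<le> \<delta>" "0 < \<rho>" "\<rho> \<le> 1"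
    and "g k \<in> borel_measurable (\<FF> k)" "\<sigma> k \<in> borel_measurable (\<FF> k)"
    and "AE \<omega> in M. vec_cond_exp M (\<FF> k) (g (Suc k)) \<omega> = gradF (x k \<omega>)"
    and "AE \<omega> in M. nn_cond_exp M (\<FF> k) (\<lambda>\<omega>. ennreal ((norm (g (Suc k) \<omega> - gradF xs))\<^sup>2)) \<omega>
        \<le> ennreal (2 * \<alpha> * D k \<omega> + \<beta> * (\<sigma> k \<omega>)\<^sup>2)"
    and "AE \<omega> in M. nn_cond_exp M (\<FF> k) (\<lambda>\<omega>. ennreal ((\<sigma> (Suc k) \<omega>)\<^sup>2)) \<omega>
        \<le> ennreal ((1 - \<rho>) * (\<sigma> k \<omega>)\<^sup>2 + 2 * \<delta> * D k \<omega>)"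
  using SGA unfolding stochastic_gradient_assumption_def by auto

lemma adapted_y_Suc_x:
  assumes [measurable]: "p k \<in> borel_measurable (\<FF> k)" "y k \<in> borel_measurable (\<FF> k)"
  shows "y (Suc k) \<in> borel_measurable (\<FF> k)" "x k \<in> borel_measurable (\<FF> k)"
proof -
  note [measurable] = measurable_linear_comp[OF L] measurable_linear_comp[OF adjoint_linear[OF L]]
  have "(\<lambda>\<omega>. prox (\<lambda>z. ereal \<tau> * H' z) (y_arg k \<omega>)) \<in> borel_measurable (\<FF> k)"
    by (rule measurable_compose[OF _ borel_measurable_continuous_onI[OF continuous_on_prox]])
      (use proper_convex_lsc_scale[OF H' \<tau>] in measurable)
  then show [measurable]: "y (Suc k) \<in> borel_measurable (\<FF> k)"
    by (subst measurable_cong[where g = "\<lambda>\<omega>. prox (\<lambda>z. ereal \<tau> * H' z) (y_arg k \<omega>)"])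
      (auto simp: space_F PDDY_D)
  have "(\<lambda>\<omega>. p k \<omega> - \<gamma> *\<^sub>R A (y (Suc k) \<omega>)) \<in> borel_measurable (\<FF> k)" by measurable
  then show "x k \<in> borel_measurable (\<FF> k)"
    by (subst measurable_cong[where g = "\<lambda>\<omega>. p k \<omega> - \<gamma> *\<^sub>R A (y (Suc k) \<omega>)"])
      (auto simp: space_F PDDY_D(4))
qed

lemma measurable_F_Suc:
  "f \<in> borel_measurable (\<FF> k) \<Longrightarrow> f \<in> borel_measurable (\<FF> (Suc k))"
  using filtration.sets_F_mono[OF filtration, of k "Suc k"] space_F
  by (intro measurable_from_subalg[of "\<FF> (Suc k)" "\<FF> k"]) (auto simp: subalgebra_def)

lemma adapted: "p k \<in> borel_measurable (\<FF> k) \<and> y k \<in> borel_measurable (\<FF> k)"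
proof (induction k)
  case 0
  have "p 0 \<in> borel_measurable (\<FF> 0)"
    by (subst measurable_cong[where g = "\<lambda>_. p0"]) (auto simp: space_F PDDY_D)
  moreover have "y 0 \<in> borel_measurable (\<FF> 0)"
    by (subst measurable_cong[where g = "\<lambda>_. y0"]) (auto simp: space_F PDDY_D)
  ultimately show ?case by simp
next
  case (Suc k)
  note y_x = adapted_y_Suc_x[OF conjunct1[OF Suc] conjunct2[OF Suc]]
  note [measurable] = y_x[THEN measurable_F_Suc] conjunct1[OF Suc, THEN measurable_F_Suc] SGA_D(6)
  have "(\<lambda>\<omega>. prox (\<lambda>z. ereal \<gamma> * R z) (s_arg k \<omega>)) \<in> borel_measurable (\<FF> (Suc k))"
    by (rule measurable_compose[OF _ borel_measurable_continuous_onI[OF continuous_on_prox]])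
      (use proper_convex_lsc_scale[OF R \<gamma>] in measurable)
  then have "(\<lambda>\<omega>. p k \<omega> + prox (\<lambda>z. ereal \<gamma> * R z) (s_arg k \<omega>) - x k \<omega>) \<in> borel_measurable (\<FF> (Suc k))"
    by measurable
  then have "p (Suc k) \<in> borel_measurable (\<FF> (Suc k))"
    by (subst measurable_cong[where g = "\<lambda>\<omega>. p k \<omega> + prox (\<lambda>z. ereal \<gamma> * R z) (s_arg k \<omega>) - x k \<omega>"])
      (auto simp: space_F PDDY_D(5,6))
  with y_x show ?case by (simp add: measurable_F_Suc)
qed

lemmas adapted_p = adapted[THEN conjunct1] and adapted_y = adapted[THEN conjunct2]
lemmas adapted_x = adapted_y_Suc_x(2)[OF adapted_p adapted_y]

lemmas measurable_F_M = measurable_from_subalg[OF subalg]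

lemma square_integrable_prox:
  fixes G :: "'u::euclidean_space \<Rightarrow> ereal"
  assumes "proper_convex_lsc G" "square_integrable M f"
  shows "square_integrable M (\<lambda>\<omega>. prox G (f \<omega>))"
proof (rule square_integrable_lipschitz[OF finite_measure_axioms _ assms(2)])
  show "1-lipschitz_on UNIV (prox G)"
    by (rule lipschitz_onI) (use prox_nonexpansive[OF assms(1)] in \<open>auto simp: dist_norm\<close>)
qed

lemmas square_integrable_intros =
  square_integrable_add square_integrable_diff square_integrable_scaleR
  square_integrable_linear[OF L] square_integrable_linear[OF adjoint_linear[OF L]]
  square_integrable_const[OF finite_measure_axioms]
  square_integrable_prox[OF proper_convex_lsc_scale[OF H' \<tau>]]
  square_integrable_prox[OF proper_convex_lsc_scale[OF R \<gamma>]]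

lemma square_integrable_y_Suc_x:
  assumes "square_integrable M (p k)" "square_integrable M (y k)"
  shows "square_integrable M (y (Suc k))" "square_integrable M (x k)"
proof -
  show 1: "square_integrable M (y (Suc k))"
    by (subst square_integrable_cong[OF PDDY_D(3)], assumption) (intro square_integrable_intros assms)+
  show "square_integrable M (x k)"
    by (subst square_integrable_cong[OF PDDY_D(4)], assumption) (intro square_integrable_intros assms 1)+
qed

lemma integrable_D:
  assumes x: "square_integrable M (x k)"
  shows "integrable M (D k)" "square_integrable M (\<lambda>\<omega>. gradF (x k \<omega>))"
    and "(\<integral>\<omega>. D k \<omega> \<partial>M) \<le> (\<integral>\<omega>. (gradF (x k \<omega>) - gradF xs) \<bullet> (x k \<omega> - xs) \<partial>M)"
proof -
  show grad: "square_integrable M (\<lambda>\<omega>. gradF (x k \<omega>))"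
    using F by (intro square_integrable_lipschitz[OF finite_measure_axioms _ x]) (auto simp: convex_smooth_def)
  have int: "integrable M (\<lambda>\<omega>. (gradF (x k \<omega>) - gradF xs) \<bullet> (x k \<omega> - xs))"
    by (intro square_integrable_inner square_integrable_intros grad x)
  then show D: "integrable M (D k)"
  proof (rule Bochner_Integration.integrable_bound)
    note [measurable] = square_integrable_measurable[OF x]
    have [measurable]: "(\<lambda>\<omega>. F (x k \<omega>)) \<in> borel_measurable M"
      by (rule measurable_compose[OF _ borel_measurable_continuous_onI[OF convex_smooth_continuous[OF F]]]) simp
    show "D k \<in> borel_measurable M" unfolding bregman_smooth_def by measurable
    show "AE \<omega> in M. norm (D k \<omega>) \<le> norm ((gradF (x k \<omega>) - gradF xs) \<bullet> (x k \<omega> - xs))"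
      using D_nonneg bregman_smooth_le_inner[OF F] by (intro AE_I2) (auto intro: order_trans[OF _ abs_ge_self])
  qed
  show "(\<integral>\<omega>. D k \<omega> \<partial>M) \<le> (\<integral>\<omega>. (gradF (x k \<omega>) - gradF xs) \<bullet> (x k \<omega> - xs) \<partial>M)"
    by (intro integral_mono D int bregman_smooth_le_inner[OF F])
qed

lemma second_moments:
  assumes x: "square_integrable M (x k)" and \<sigma>: "square_integrable M (\<sigma> k)"
  shows "square_integrable M (g (Suc k))" "square_integrable M (\<sigma> (Suc k))"
    and "(\<integral>\<omega>. (norm (g (Suc k) \<omega> - gradF xs))\<^sup>2 \<partial>M)
      \<le> 2 * \<alpha> * (\<integral>\<omega>. D k \<omega> \<partial>M) + \<beta> * (\<integral>\<omega>. (\<sigma> k \<omega>)\<^sup>2 \<partial>M)"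
    and "(\<integral>\<omega>. (\<sigma> (Suc k) \<omega>)\<^sup>2 \<partial>M) \<le> (1 - \<rho>) * (\<integral>\<omega>. (\<sigma> k \<omega>)\<^sup>2 \<partial>M) + 2 * \<delta> * (\<integral>\<omega>. D k \<omega> \<partial>M)"
proof -
  interpret S: sigma_finite_subalgebra M "\<FF> k" by (rule subalgebra_F)
  note [measurable] = SGA_D(6,7)[of "Suc k", THEN measurable_F_M]
  have int: "integrable M (\<lambda>\<omega>. (\<sigma> k \<omega>)\<^sup>2)" "integrable M (D k)"
    using \<sigma> integrable_D(1)[OF x] by (auto simp: square_integrable_def)
  have "integrable M (\<lambda>\<omega>. 2 * \<alpha> * D k \<omega> + \<beta> * (\<sigma> k \<omega>)\<^sup>2)" using int by simp
  note g = S.integral_le_of_nn_cond_exp_le[OF _ _ this _ SGA_D(9)]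
  have "integrable M (\<lambda>\<omega>. (1 - \<rho>) * (\<sigma> k \<omega>)\<^sup>2 + 2 * \<delta> * D k \<omega>)" using int by simp
  note s = S.integral_le_of_nn_cond_exp_le[OF _ _ this _ SGA_D(10)]
  have "integrable M (\<lambda>\<omega>. (norm (g (Suc k) \<omega> - gradF xs))\<^sup>2)"
    by (rule g(1)) (use SGA_D D_nonneg in auto)
  then have "square_integrable M (\<lambda>\<omega>. g (Suc k) \<omega> - gradF xs)" by (simp add: square_integrable_def)
  from square_integrable_add[OF this square_integrable_const[OF finite_measure_axioms, of "gradF xs"]]
  show "square_integrable M (g (Suc k))" by simp
  have "integrable M (\<lambda>\<omega>. (\<sigma> (Suc k) \<omega>)\<^sup>2)"
    by (rule s(1)) (use SGA_D D_nonneg in auto)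
  then show "square_integrable M (\<sigma> (Suc k))" by (simp add: square_integrable_def)
  have "(\<integral>\<omega>. (norm (g (Suc k) \<omega> - gradF xs))\<^sup>2 \<partial>M) \<le> (\<integral>\<omega>. 2 * \<alpha> * D k \<omega> + \<beta> * (\<sigma> k \<omega>)\<^sup>2 \<partial>M)"
    by (rule g(2)) (use SGA_D D_nonneg in auto)
  then show "(\<integral>\<omega>. (norm (g (Suc k) \<omega> - gradF xs))\<^sup>2 \<partial>M)
      \<le> 2 * \<alpha> * (\<integral>\<omega>. D k \<omega> \<partial>M) + \<beta> * (\<integral>\<omega>. (\<sigma> k \<omega>)\<^sup>2 \<partial>M)"
    using int by simp
  have "(\<integral>\<omega>. (\<sigma> (Suc k) \<omega>)\<^sup>2 \<partial>M) \<le> (\<integral>\<omega>. (1 - \<rho>) * (\<sigma> k \<omega>)\<^sup>2 + 2 * \<delta> * D k \<omega> \<partial>M)"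
    by (rule s(2)) (use SGA_D D_nonneg in auto)
  then show "(\<integral>\<omega>. (\<sigma> (Suc k) \<omega>)\<^sup>2 \<partial>M) \<le> (1 - \<rho>) * (\<integral>\<omega>. (\<sigma> k \<omega>)\<^sup>2 \<partial>M) + 2 * \<delta> * (\<integral>\<omega>. D k \<omega> \<partial>M)"
    using int by simp
qed

lemma square_integrable_s_Suc:
  assumes "square_integrable M (p k)" "square_integrable M (x k)" "square_integrable M (g (Suc k))"
  shows "square_integrable M (s (Suc k))"
  by (subst square_integrable_cong[OF PDDY_D(5)], assumption) (intro square_integrable_intros assms)+

lemma square_integrable_iterates:
  "square_integrable M (p k) \<and> square_integrable M (y k) \<and> square_integrable M (\<sigma> k)"
proof (induction k)
  case 0
  show ?case
    by (auto simp: square_integrable_cong[OF PDDY_D(1)] square_integrable_cong[OF PDDY_D(2)]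
        square_integrable_cong[OF \<sigma>0] intro: square_integrable_intros)
next
  case (Suc k)
  then have p: "square_integrable M (p k)" and y: "square_integrable M (y k)"
    and \<sigma>: "square_integrable M (\<sigma> k)" by auto
  note y_x = square_integrable_y_Suc_x[OF p y]
  note g_\<sigma> = second_moments(1,2)[OF y_x(2) \<sigma>]
  have "square_integrable M (p (Suc k))"
    by (subst square_integrable_cong[OF PDDY_D(6)], assumption)
      (intro square_integrable_intros p y_x square_integrable_s_Suc g_\<sigma>)+
  with y_x g_\<sigma> show ?case by simp
qed

lemma square_integrable_all:
  shows "square_integrable M (p k)" "square_integrable M (y k)" "square_integrable M (\<sigma> k)"
    "square_integrable M (x k)" "square_integrable M (g (Suc k))" "square_integrable M (s (Suc k))"
proof -
  show 1: "square_integrable M (p k)" "square_integrable M (y k)" "square_integrable M (\<sigma> k)"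
    using square_integrable_iterates by auto
  then show 2: "square_integrable M (x k)" by (intro square_integrable_y_Suc_x)
  then show "square_integrable M (g (Suc k))" using 1 by (intro second_moments)
  then show "square_integrable M (s (Suc k))" using 1 2 by (intro square_integrable_s_Suc)
qed

lemma integrable_gaps: "integrable M (dual_gap k)" "integrable M (primal_gap k)"
  unfolding dual_gap_def primal_gap_def h_def r_def
  by (intro square_integrable_inner square_integrable_intros square_integrable_all)+

lemma integrable_norm_P:
  "integrable M (\<lambda>\<omega>. (norm_P \<gamma> \<tau> L ((p k \<omega>, y k \<omega>) - (xs + \<gamma> *\<^sub>R A ys, ys)))\<^sup>2)"
proof -
  have "square_integrable M (\<lambda>\<omega>. p k \<omega> - (xs + \<gamma> *\<^sub>R A ys))" "square_integrable M (\<lambda>\<omega>. y k \<omega> - ys)"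
    "square_integrable M (\<lambda>\<omega>. A (y k \<omega> - ys))"
    by (intro square_integrable_intros square_integrable_all)+
  then show ?thesis
    by (simp add: norm_P_power2[OF L \<gamma> \<tau> step_product] square_integrable_def)
qed

lemma V_nonneg: "0 \<le> V k \<omega>"
  using SGA_D unfolding V_def by simp

lemma unbiased:
  "(\<integral>\<omega>. (g (Suc k) \<omega> - gradF xs) \<bullet> (x k \<omega> - xs) \<partial>M)
    = (\<integral>\<omega>. (gradF (x k \<omega>) - gradF xs) \<bullet> (x k \<omega> - xs) \<partial>M)"
proof -
  interpret S: sigma_finite_subalgebra M "\<FF> k" by (rule subalgebra_F)
  have d: "square_integrable M (\<lambda>\<omega>. x k \<omega> - xs)"
    by (intro square_integrable_intros square_integrable_all)
  note grad = integrable_D(2)[OF square_integrable_all(4)]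
  have "(\<integral>\<omega>. gradF (x k \<omega>) \<bullet> (x k \<omega> - xs) \<partial>M) = (\<integral>\<omega>. g (Suc k) \<omega> \<bullet> (x k \<omega> - xs) \<partial>M)"
    by (rule S.integral_inner_vec_cond_exp[OF square_integrable_all(5) d _ SGA_D(8)])
      (use adapted_x grad square_integrable_measurable in auto)
  then show ?thesis
    using square_integrable_inner[OF square_integrable_all(5) d] square_integrable_inner[OF grad d]
      square_integrable_inner[OF square_integrable_const[OF finite_measure_axioms] d]
    by (simp add: inner_diff_left)
qed

lemma V_decrease:
  "(\<integral>\<omega>. V (Suc k) \<omega> \<partial>M) + \<gamma> * (\<integral>\<omega>. D k \<omega> + dual_gap k \<omega> + primal_gap k \<omega> \<partial>M) \<le> (\<integral>\<omega>. V k \<omega> \<partial>M)"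
proof -
  let ?q = "\<lambda>k \<omega>. (norm_P \<gamma> \<tau> L ((p k \<omega>, y k \<omega>) - (xs + \<gamma> *\<^sub>R A ys, ys)))\<^sup>2"
  let ?e = "\<lambda>\<omega>. g (Suc k) \<omega> - gradF xs"
  have e: "square_integrable M ?e" and d: "square_integrable M (\<lambda>\<omega>. x k \<omega> - xs)"
    by (intro square_integrable_intros square_integrable_all)+
  note int = integrable_norm_P integrable_gaps square_integrable_inner[OF e d]
    integrable_D(1)[OF square_integrable_all(4)]
  have int': "integrable M (\<lambda>\<omega>. (norm (?e \<omega>))\<^sup>2)" using e by (simp add: square_integrable_def)
  have int\<sigma>: "integrable M (\<lambda>\<omega>. (\<sigma> k \<omega>)\<^sup>2)" for k
    using square_integrable_all(3) by (simp add: square_integrable_def)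
  let ?D = "\<integral>\<omega>. D k \<omega> \<partial>M" and ?H = "\<integral>\<omega>. dual_gap k \<omega> \<partial>M" and ?R = "\<integral>\<omega>. primal_gap k \<omega> \<partial>M"
    and ?S = "\<lambda>k. \<integral>\<omega>. (\<sigma> k \<omega>)\<^sup>2 \<partial>M"
  have "(\<integral>\<omega>. ?q (Suc k) \<omega> \<partial>M) \<le> (\<integral>\<omega>. ?q k \<omega> - 2 * \<gamma> * (?e \<omega> \<bullet> (x k \<omega> - xs)) - 2 * \<gamma> * primal_gap k \<omega>
      - 2 * \<gamma> * dual_gap k \<omega> + \<gamma>\<^sup>2 * (norm (?e \<omega>))\<^sup>2 \<partial>M)"
  proof (rule integral_mono)
    fix \<omega> assume \<omega>: "\<omega> \<in> space M"
    show "?q (Suc k) \<omega> \<le> ?q k \<omega> - 2 * \<gamma> * (?e \<omega> \<bullet> (x k \<omega> - xs)) - 2 * \<gamma> * primal_gap k \<omega>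
      - 2 * \<gamma> * dual_gap k \<omega> + \<gamma>\<^sup>2 * (norm (?e \<omega>))\<^sup>2"
      unfolding primal_gap_def dual_gap_def
      using PDDY_step[OF L \<gamma> \<tau> step_product primal refl PDDY_D(4)[OF \<omega>] refl PDDY_D(6)[OF \<omega>]
          h_def r_def, where xs = xs]
      unfolding dual[symmetric] .
  qed (intro Bochner_Integration.integrable_add Bochner_Integration.integrable_diff integrable_mult_right int int')+
  also have "\<dots> = (\<integral>\<omega>. ?q k \<omega> \<partial>M) - 2 * \<gamma> * (\<integral>\<omega>. ?e \<omega> \<bullet> (x k \<omega> - xs) \<partial>M) - 2 * \<gamma> * ?R
      - 2 * \<gamma> * ?H + \<gamma>\<^sup>2 * (\<integral>\<omega>. (norm (?e \<omega>))\<^sup>2 \<partial>M)"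
    using int int' by simp
  also have "\<dots> \<le> (\<integral>\<omega>. ?q k \<omega> \<partial>M) - 2 * \<gamma> * ?D - 2 * \<gamma> * ?R - 2 * \<gamma> * ?H + \<gamma>\<^sup>2 * (2 * \<alpha> * ?D + \<beta> * ?S k)"
    using integrable_D(3)[OF square_integrable_all(4), of k] \<gamma>
      second_moments(3)[OF square_integrable_all(4,3), of k]
    unfolding unbiased by (intro add_mono diff_right_mono diff_left_mono mult_left_mono) auto
  finally have q: "(\<integral>\<omega>. ?q (Suc k) \<omega> \<partial>M) \<le> (\<integral>\<omega>. ?q k \<omega> \<partial>M) - 2 * \<gamma> * ?D - 2 * \<gamma> * ?R - 2 * \<gamma> * ?H
      + \<gamma>\<^sup>2 * (2 * \<alpha> * ?D + \<beta> * ?S k)" .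
  have "\<gamma>\<^sup>2 * (\<beta> / \<rho>) * ?S (Suc k) \<le> \<gamma>\<^sup>2 * (\<beta> / \<rho>) * ((1 - \<rho>) * ?S k + 2 * \<delta> * ?D)"
    using second_moments(4)[OF square_integrable_all(4,3), of k] SGA_D by (intro mult_left_mono) auto
  also have "\<dots> = \<gamma>\<^sup>2 * (\<beta> / \<rho>) * ?S k - \<gamma>\<^sup>2 * \<beta> * ?S k + 2 * \<gamma>\<^sup>2 * (\<beta> / \<rho> * \<delta>) * ?D"
    using SGA_D by (simp add: field_simps)
  finally have \<sigma>: "\<gamma>\<^sup>2 * (\<beta> / \<rho>) * ?S (Suc k)
      \<le> \<gamma>\<^sup>2 * (\<beta> / \<rho>) * ?S k - \<gamma>\<^sup>2 * \<beta> * ?S k + 2 * \<gamma>\<^sup>2 * (\<beta> / \<rho> * \<delta>) * ?D" .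
  have "0 \<le> ?D" using D_nonneg by simp
  then have "2 * \<gamma> * (\<gamma> * (\<alpha> + \<beta> / \<rho> * \<delta>)) * ?D \<le> 2 * \<gamma> * (1 / 2) * ?D"
    using \<gamma> step_bound by (intro mult_right_mono mult_left_mono) auto
  then have step: "2 * \<gamma>\<^sup>2 * \<alpha> * ?D + 2 * \<gamma>\<^sup>2 * (\<beta> / \<rho> * \<delta>) * ?D \<le> \<gamma> * ?D"
    by (simp add: power2_eq_square algebra_simps)
  have gaps: "0 \<le> \<gamma> * ?R" "0 \<le> \<gamma> * ?H"
    using gaps_nonneg \<gamma> by (auto intro!: mult_nonneg_nonneg integral_nonneg_AE AE_I2)
  have V: "(\<integral>\<omega>. V k \<omega> \<partial>M) = (\<integral>\<omega>. ?q k \<omega> \<partial>M) + \<gamma>\<^sup>2 * (\<beta> / \<rho>) * ?S k" for k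
    unfolding V_def using integrable_norm_P int\<sigma> by simp
  have "(\<integral>\<omega>. D k \<omega> + dual_gap k \<omega> + primal_gap k \<omega> \<partial>M) = ?D + ?H + ?R"
    using int by simp
  then show ?thesis
    unfolding V using q \<sigma> step gaps by (simp add: algebra_simps)
qed

lemma sum_gaps_le:
  "\<gamma> * (\<integral>\<omega>. (\<Sum>j<n. D j \<omega> + dual_gap j \<omega> + primal_gap j \<omega>) \<partial>M)
    \<le> (norm_P \<gamma> \<tau> L ((p0, y0) - (xs + \<gamma> *\<^sub>R A ys, ys)))\<^sup>2 + \<gamma>\<^sup>2 * (\<beta> / \<rho>) * \<sigma>0\<^sup>2"
proof -
  have int: "integrable M (\<lambda>\<omega>. D j \<omega> + dual_gap j \<omega> + primal_gap j \<omega>)" for j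
    using integrable_gaps integrable_D(1)[OF square_integrable_all(4)] by simp
  have "(\<integral>\<omega>. V n \<omega> \<partial>M) + \<gamma> * (\<integral>\<omega>. (\<Sum>j<n. D j \<omega> + dual_gap j \<omega> + primal_gap j \<omega>) \<partial>M)
      \<le> (\<integral>\<omega>. V 0 \<omega> \<partial>M)"
  proof (induction n)
    case (Suc n)
    have "(\<integral>\<omega>. (\<Sum>j<Suc n. D j \<omega> + dual_gap j \<omega> + primal_gap j \<omega>) \<partial>M)
      = (\<integral>\<omega>. (\<Sum>j<n. D j \<omega> + dual_gap j \<omega> + primal_gap j \<omega>) \<partial>M)
        + (\<integral>\<omega>. D n \<omega> + dual_gap n \<omega> + primal_gap n \<omega> \<partial>M)"
      unfolding sum.lessThan_Suc
      by (intro Bochner_Integration.integral_add Bochner_Integration.integrable_sum int)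
    then show ?case using Suc V_decrease[of n] by (simp only: distrib_left)
  qed simp
  moreover have "0 \<le> (\<integral>\<omega>. V n \<omega> \<partial>M)" using V_nonneg by simp
  moreover have "(\<integral>\<omega>. V 0 \<omega> \<partial>M)
      = (\<integral>\<omega>. (norm_P \<gamma> \<tau> L ((p0, y0) - (xs + \<gamma> *\<^sub>R A ys, ys)))\<^sup>2 + \<gamma>\<^sup>2 * (\<beta> / \<rho>) * \<sigma>0\<^sup>2 \<partial>M)"
    by (rule Bochner_Integration.integral_cong) (simp_all add: V_def PDDY_D \<sigma>0)
  ultimately show ?thesis by (simp add: prob_space)
qed

lemma bregman_means_le:
  assumes "1 \<le> k" and \<omega>: "\<omega> \<in> space M"
  shows "ereal (bregman_smooth F gradF ((1 / real k) *\<^sub>R (\<Sum>j<k. x j \<omega>)) xs)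
      + bregman H' hs ((1 / real k) *\<^sub>R (\<Sum>j=1..k. y j \<omega>)) ys
      + bregman R rs ((1 / real k) *\<^sub>R (\<Sum>j=1..k. s j \<omega>)) xs
    \<le> ereal ((1 / real k) * (\<Sum>j<k. D j \<omega> + dual_gap j \<omega> + primal_gap j \<omega>))"
proof -
  have k: "{..<k} \<noteq> {}" using assms(1) by (auto simp: lessThan_empty_iff)
  have shift: "(\<Sum>j=1..k. f j) = (\<Sum>j<k. f (Suc j))" for f :: "nat \<Rightarrow> 'u::comm_monoid_add"
    by (rule sum.reindex_bij_witness[of _ Suc "\<lambda>j. j - 1"]) auto
  have "ereal (bregman_smooth F gradF ((1 / real k) *\<^sub>R (\<Sum>j<k. x j \<omega>)) xs)
      \<le> ereal ((1 / real k) * (\<Sum>j<k. D j \<omega>))"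
    using bregman_smooth_mean_le[OF F finite_lessThan k] by simp
  moreover have "bregman H' hs ((1 / real k) *\<^sub>R (\<Sum>j=1..k. y j \<omega>)) ys
      \<le> ereal ((1 / real k) * (\<Sum>j<k. dual_gap j \<omega>))"
    using bregman_mean_le[OF H' hs finite_lessThan k subgradients(1)[OF \<omega>]]
    unfolding shift dual_gap_def by simp
  moreover have "bregman R rs ((1 / real k) *\<^sub>R (\<Sum>j=1..k. s j \<omega>)) xs
      \<le> ereal ((1 / real k) * (\<Sum>j<k. primal_gap j \<omega>))"
    using bregman_mean_le[OF R rs finite_lessThan k subgradients(2)[OF \<omega>]]
    unfolding shift primal_gap_def by simp
  ultimately have "ereal (bregman_smooth F gradF ((1 / real k) *\<^sub>R (\<Sum>j<k. x j \<omega>)) xs)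
      + bregman H' hs ((1 / real k) *\<^sub>R (\<Sum>j=1..k. y j \<omega>)) ys
      + bregman R rs ((1 / real k) *\<^sub>R (\<Sum>j=1..k. s j \<omega>)) xs
    \<le> ereal ((1 / real k) * (\<Sum>j<k. D j \<omega>)) + ereal ((1 / real k) * (\<Sum>j<k. dual_gap j \<omega>))
      + ereal ((1 / real k) * (\<Sum>j<k. primal_gap j \<omega>))"
    by (intro add_mono)
  then show ?thesis by (simp add: sum.distrib distrib_left)
qed

lemma expected_bregman_means_le:
  assumes k: "1 \<le> k"
  shows "(\<integral>\<^sup>+\<omega>. e2ennreal (
        ereal (bregman_smooth F gradF ((1 / real k) *\<^sub>R (\<Sum>j<k. x j \<omega>)) xs)
      + bregman H' hs ((1 / real k) *\<^sub>R (\<Sum>j=1..k. y j \<omega>)) ys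
      + bregman R rs ((1 / real k) *\<^sub>R (\<Sum>j=1..k. s j \<omega>)) xs) \<partial>M)
    \<le> ennreal (((norm_P \<gamma> \<tau> L ((p0, y0) - (xs + \<gamma> *\<^sub>R A ys, ys)))\<^sup>2 + \<gamma>\<^sup>2 * (\<beta> / \<rho>) * \<sigma>0\<^sup>2)
        / (real k * \<gamma>))"
    (is "(\<integral>\<^sup>+\<omega>. e2ennreal (?B \<omega>) \<partial>M) \<le> ennreal (?V / _)")
proof -
  let ?T = "\<lambda>\<omega>. \<Sum>j<k. D j \<omega> + dual_gap j \<omega> + primal_gap j \<omega>"
  have int: "integrable M ?T"
    using integrable_gaps integrable_D(1)[OF square_integrable_all(4)] by simp
  have nonneg: "0 \<le> ?T \<omega>" if "\<omega> \<in> space M" for \<omega>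
    using gaps_nonneg[OF that] D_nonneg by (intro sum_nonneg add_nonneg_nonneg)
  have "(\<integral>\<^sup>+\<omega>. e2ennreal (?B \<omega>) \<partial>M) \<le> (\<integral>\<^sup>+\<omega>. ennreal ((1 / real k) * ?T \<omega>) \<partial>M)"
  proof (rule nn_integral_mono)
    fix \<omega> assume "\<omega> \<in> space M"
    from e2ennreal_mono[OF bregman_means_le[OF k this]]
    show "e2ennreal (?B \<omega>) \<le> ennreal ((1 / real k) * ?T \<omega>)" by simp
  qed
  also have "\<dots> = ennreal (\<integral>\<omega>. (1 / real k) * ?T \<omega> \<partial>M)"
    using int nonneg by (intro nn_integral_eq_integral integrable_mult_right AE_I2 mult_nonneg_nonneg) auto
  also have "(\<integral>\<omega>. (1 / real k) * ?T \<omega> \<partial>M) = (1 / real k) * (\<integral>\<omega>. ?T \<omega> \<partial>M)"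
    by (rule integral_mult_right_zero)
  also have "ennreal \<dots> \<le> ennreal (?V / (real k * \<gamma>))"
    using sum_gaps_le[of k] \<gamma> k by (intro ennreal_leI) (simp add: field_simps)
  finally show ?thesis .
qed

end

theorem theorem5p2:
  fixes M :: "'w measure" and \<FF> :: "nat \<Rightarrow> 'w measure"
    and L :: "'a::euclidean_space \<Rightarrow> 'b::euclidean_space"
    and F :: "'a \<Rightarrow> real" and gradF :: "'a \<Rightarrow> 'a"
    and R :: "'a \<Rightarrow> ereal" and H :: "'b \<Rightarrow> ereal"
    and xs rs :: 'a and ys hs :: 'b and p0 :: 'a and y0 :: 'b
    and g p x s :: "nat \<Rightarrow> 'w \<Rightarrow> 'a" and y :: "nat \<Rightarrow> 'w \<Rightarrow> 'b"
    and \<sigma> :: "nat \<Rightarrow> 'w \<Rightarrow> real"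
    and \<nu> \<gamma> \<tau> \<alpha> \<beta> \<delta> \<rho> \<kappa> \<sigma>0 V0 :: real and k :: nat
  assumes L: "linear L"
    and F: "\<nu> > 0" "convex_smooth \<nu> F gradF"
    and R: "proper_convex_lsc R"
    and H: "proper_convex_lsc H"
    and primal_dual: "rs \<in> subdifferential R xs" "hs \<in> subdifferential (conjugate H) ys"
      "gradF xs + rs + adjoint L ys = 0" "hs = L xs"
    and filtered: "prob_space M" "filtration (space M) \<FF>" "\<And>j. subalgebra M (\<FF> j)"
    and steps: "\<gamma> > 0" "\<tau> > 0"
    and PDDY: "stochastic_PDDY (space M) \<gamma> \<tau> L R H g p0 y0 p y x s"
    and SGA: "stochastic_gradient_assumption M \<FF> F gradF xs x g \<sigma> \<alpha> \<beta> \<delta> \<rho>"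
    and \<sigma>0: "\<And>\<omega>. \<omega> \<in> space M \<Longrightarrow> \<sigma> 0 \<omega> = \<sigma>0"
    and \<kappa>: "\<kappa> = \<beta> / \<rho>"
    (* division in ereal: the bound is infinite when alpha + kappa * delta = 0 *)
    and step_bound: "ereal \<gamma> \<le> 1 / ereal (2 * (\<alpha> + \<kappa> * \<delta>))"
    and step_product: "\<gamma> * \<tau> * (onorm L)\<^sup>2 < 1"
    and V0: "V0 = (norm_P \<gamma> \<tau> L ((p0, y0) - (xs + \<gamma> *\<^sub>R adjoint L ys, ys)))\<^sup>2
               + \<gamma>\<^sup>2 * \<kappa> * \<sigma>0\<^sup>2"
    and k: "k \<ge> 1"
  (* expectation of a [0, infinity]-valued variable: the three divergences are nonnegative *)
  shows "(\<integral>\<^sup>+\<omega>. e2ennreal (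
             ereal (bregman_smooth F gradF ((1 / real k) *\<^sub>R (\<Sum>j<k. x j \<omega>)) xs)
           + bregman (conjugate H) hs ((1 / real k) *\<^sub>R (\<Sum>j=1..k. y j \<omega>)) ys
           + bregman R rs ((1 / real k) *\<^sub>R (\<Sum>j=1..k. s j \<omega>)) xs) \<partial>M)
         \<le> ennreal (V0 / (real k * \<gamma>))"
proof -
  have "0 \<le> \<alpha>" "0 \<le> \<beta>" "0 \<le> \<delta>" "0 < \<rho>"
    using SGA unfolding stochastic_gradient_assumption_def by auto
  then have "0 \<le> \<alpha> + \<kappa> * \<delta>" unfolding \<kappa> by simp
  then have bound: "\<gamma> * (\<alpha> + \<kappa> * \<delta>) \<le> 1 / 2"
  proof (cases "\<alpha> + \<kappa> * \<delta> = 0")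
    case False
    with \<open>0 \<le> \<alpha> + \<kappa> * \<delta>\<close> have "0 < \<alpha> + \<kappa> * \<delta>" by simp
    moreover from this have "\<gamma> \<le> 1 / (2 * (\<alpha> + \<kappa> * \<delta>))"
      using step_bound by (simp add: one_ereal_def)
    ultimately show ?thesis by (simp add: field_simps)
  qed simp
  interpret stochastic_PDDY_iteration M \<FF> L F gradF R H xs rs ys hs p0 y0 g p x s y \<sigma> \<nu> \<gamma> \<tau> \<alpha> \<beta> \<delta> \<rho> \<sigma>0
    by (rule stochastic_PDDY_iteration.intro[OF L F(2) R H primal_dual filtered steps PDDY SGA \<sigma>0
          bound[unfolded \<kappa>] less_imp_le[OF step_product]])
  show ?thesis
    using expected_bregman_means_le[OF k] unfolding V0 \<kappa> .
qed

end
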